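(* Let $1\le p\le\infty$. Then (i) For any function $f\in\mathcal{R}_n$ ($n\ge1$) with the set of poles $a=\{a_k\}$ (repeated counting multiplicities) we have $$|f'(\xi)|\le\bigg(\mathcal{D}_1^{\frac1p}(a)\sum_{|a_k|<1}\frac{1-|a_k|^2}{|a_k-\xi|^2}+\mathcal{D}_2^{\frac1p}(a)\sum_{|a_k|>1}\frac{|a_k|^2-1}{|a_k-\xi|^2}\bigg)\|f\|_{L^p}$$ for all $|\xi|=1$, where $$\mathcal{D}_1(a)=\sum_{|a_k|<1}\frac{1+|a_k|}{1-|a_k|},\qquad \mathcal{D}_2(a)=\sum_{|a_k|>1}\frac{|a_k|+1}{|a_k|-1}.$$ (ii) Moreover, the inequality in (i) is sharp in the following sense: for any $p\in[1,\infty]$ there exists a constant $c(p)>0$ such that for any $n\ge2$ and any $r\in(0,1)$ there exists $f\in\mathcal{R}_n$ with the poles $a=\{a_k\}$ on the circle $\{|z|=\frac1r\}$ such that $$\frac{f'(-1)}{\|f\|_{L^p}}\ge c(p)\,\mathcal{D}_2^{\frac1p}(a)\sum_{|a_k|>1}\frac{|a_k|^2-1}{|a_k+1|^2}.$$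
   Context: $\mathbb{T}=\{\xi\in\mathbb{C}:|\xi|=1\}$, $m$ is the normalized Lebesgue measure on $\mathbb{T}$, and $\|\cdot\|_{L^p}$ is the standard norm of $L^p(\mathbb{T},m)$. $\mathcal{P}_n$ is the space of complex polynomials of degree at most $n$, and $\mathcal{R}_n=\{P/Q:\ P,Q\in\mathcal{P}_n,\ Q(\xi)\ne0\text{ for }|\xi|=1\}$ is the set of rational functions of degree at most $n$ without poles on $\mathbb{T}$. For $p=\infty$, $\frac1p$ is read as $0$.
   Formalization: Poles are counted on the Riemann sphere: a pole at infinity, with its multiplicity, contributes the limit value 1 to D_2(a) and to the sum over |a_k|>1; with finite poles only, (i) fails for f(z)=z. *)

theory Defs
  imports
    "HOL-Complex_Analysis.Complex_Analysis"
    "HOL-Probability.Essential_Supremum"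
begin

definition circle_measure :: "complex measure" where
  "circle_measure =
     distr (uniform_measure lborel {-pi<..pi}) (restrict_space borel (sphere 0 1)) cis"

text \<open>
  The norm is real-valued; it is only meant for functions of finite norm, such as functions
  that are continuous on the unit circle. For \<open>p = \<infinity>\<close> it is the essential supremum.
\<close>

definition Lp_norm :: "ennreal \<Rightarrow> (complex \<Rightarrow> complex) \<Rightarrow> real" where
  "Lp_norm p f =
     (if p = \<infinity> then real_of_ereal (esssup circle_measure (\<lambda>\<xi>. ereal (norm (f \<xi>))))
      else (LINT \<xi>|circle_measure. norm (f \<xi>) powr enn2real p) powr (1 / enn2real p))"

text \<open>
  The values of these functions at the zeros of \<open>Q\<close> are a convention of division by zero. They do
  not influence the poles and their orders, nor the values and derivatives on the unit circle.
\<close>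

definition rational_functions :: "nat \<Rightarrow> (complex \<Rightarrow> complex) set" where
  "rational_functions n =
     {f. \<exists>P Q :: complex poly. degree P \<le> n \<and> degree Q \<le> n \<and>
           (\<forall>\<xi>. norm \<xi> = 1 \<longrightarrow> poly Q \<xi> \<noteq> 0) \<and> f = (\<lambda>z. poly P z / poly Q z)}"

text \<open>
  The poles of a rational function are its poles on the Riemann sphere. A pole at infinity has to
  be counted: the function \<open>z ^ n\<close> has no other poles, and the derivative bound would fail for it
  if that pole were ignored.
\<close>

definition pole_mult :: "(complex \<Rightarrow> complex) \<Rightarrow> complex \<Rightarrow> nat" where
  "pole_mult f a = (if is_pole f a then nat (- zorder f a) else 0)"

definition pole_mult_infinity :: "(complex \<Rightarrow> complex) \<Rightarrow> nat" where
  "pole_mult_infinity f = pole_mult (\<lambda>w. f (inverse w)) 0"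

definition D1 :: "(complex \<Rightarrow> complex) \<Rightarrow> real" where
  "D1 f = (\<Sum>a | is_pole f a \<and> norm a < 1.
             real (pole_mult f a) * ((1 + norm a) / (1 - norm a)))"

text \<open>
  In the sums over the poles outside the closed unit disc, the summands
  \<open>(|a| + 1) / (|a| - 1)\<close> and \<open>(|a|\<^sup>2 - 1) / |a - \<xi>|\<^sup>2\<close> are given their limit \<open>1\<close> at \<open>a = \<infinity>\<close>.
\<close>

definition D2 :: "(complex \<Rightarrow> complex) \<Rightarrow> real" where
  "D2 f = (\<Sum>a | is_pole f a \<and> norm a > 1.
             real (pole_mult f a) * ((norm a + 1) / (norm a - 1)))
          + real (pole_mult_infinity f)"

definition inner_pole_sum :: "(complex \<Rightarrow> complex) \<Rightarrow> complex \<Rightarrow> real" where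
  "inner_pole_sum f \<xi> = (\<Sum>a | is_pole f a \<and> norm a < 1.
      real (pole_mult f a) * ((1 - (norm a)\<^sup>2) / (norm (a - \<xi>))\<^sup>2))"

definition outer_pole_sum :: "(complex \<Rightarrow> complex) \<Rightarrow> complex \<Rightarrow> real" where
  "outer_pole_sum f \<xi> = (\<Sum>a | is_pole f a \<and> norm a > 1.
      real (pole_mult f a) * (((norm a)\<^sup>2 - 1) / (norm (a - \<xi>))\<^sup>2))
      + real (pole_mult_infinity f)"

text \<open>
  All \<open>n\<close> poles of \<open>f\<close>, counted with multiplicity, lie on the circle of radius \<open>R\<close> about 0. The
  count rules out constants, which have no poles at all and for which a lower bound in terms of
  the poles would say nothing.
\<close>

definition has_poles_on_circle :: "nat \<Rightarrow> real \<Rightarrow> (complex \<Rightarrow> complex) \<Rightarrow> bool" where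
  "has_poles_on_circle n R f \<longleftrightarrow>
     (\<forall>a. is_pole f a \<longrightarrow> norm a = R) \<and> pole_mult_infinity f = 0 \<and>
     (\<Sum>a | is_pole f a. pole_mult f a) = n"

end

theory Submission
  imports Defs "HOL-Probability.Probability_Measure"
begin

text \<open>
  The derivative at \<open>\<xi>\<close> splits into a part that sees only the poles inside the disc and a part
  that sees only those outside. For \<open>f\<close> analytic on the circle, let \<open>T f \<xi>\<close> be the mean over
  \<open>u\<close> of \<open>u\<close> times the second difference quotient \<open>(f u - f \<xi> - f' \<xi> (u - \<xi>)) / (u - \<xi>)\<^sup>2\<close>. By
  Cauchy's theorem \<open>T\<close> annihilates every function that is analytic on the closed disc. The
  substitution of \<open>1 / u\<close> for \<open>u\<close> maps the circle to itself and exchanges the two sides of it,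
  and it yields \<open>f' \<xi> = (cnj \<xi>)\<^sup>2 T (f \<circ> inverse) (cnj \<xi>) - T f \<xi>\<close>
  (\<open>deriv_eq_inner_part_functionals\<close>). So it is enough to bound \<open>T f \<xi>\<close> in terms of the poles
  inside; the bound for the poles outside, with the pole at infinity moved to \<open>0\<close>, is the same
  bound for \<open>f \<circ> inverse\<close>.

  Let \<open>B\<close> be the Blaschke product whose zeros are the poles of \<open>f\<close> inside. Since \<open>f B\<close> and
  \<open>f B\<^sup>2\<close> extend analytically to the disc, \<open>f\<close> may be multiplied by \<open>(1 - B / B \<xi>)\<^sup>2\<close> before
  \<open>T\<close> is applied, and this factor cancels the double pole at \<open>\<xi>\<close>. Hence \<open>T f \<xi>\<close> is the mean of
  \<open>u f u (k u / B \<xi>)\<^sup>2\<close> with \<open>k u = (B u - B \<xi>) / (u - \<xi>)\<close>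
  (\<open>inner_part_functional_eq_kernel\<close>). The weight \<open>|k|\<^sup>2\<close> has mean exactly \<open>S \<xi>\<close>, the sum of
  the Poisson kernels of the zeros at \<open>\<xi>\<close> (\<open>integral_norm_difference_quotient_blaschke\<close>), and
  it is at most \<open>S \<xi> S u\<close>, hence at most \<open>D1 f\<close> times \<open>S \<xi>\<close>
  (\<open>difference_quotient_blaschke_bound\<close>, \<open>poisson_sum_le\<close>). Hoelder's inequality between these
  two facts, the mean and the maximum of the weight, gives the power \<open>1 / p\<close> of \<open>D1 f\<close>.

  For the sharpness, all poles are put at \<open>- 1 / r\<close>. The Moebius map
  \<open>\<phi> z = - (z + r) / (1 + r z)\<close> preserves the circle, sends \<open>-1\<close> to \<open>1\<close> and that pole to
  infinity, so a polynomial of degree \<open>n\<close> in \<open>\<phi>\<close> has all its \<open>n\<close> poles there. The polynomial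
  is, up to a unimodular factor, the square of an averaged geometric sum, concentrated near
  \<open>1\<close>, times \<open>(1 + v)\<^sup>2\<close>, which suppresses the point \<open>v = -1\<close> where the change of variables
  concentrates its mass. The mean of its modulus is bounded by a multiple of the mean of the
  squared difference quotient of a Blaschke product, this time with its only zero at \<open>- r\<close>.
\<close>

section \<open>Normalized arc length on the unit circle\<close>

lemma space_circle_measure [simp]: "space circle_measure = sphere 0 1"
  by (simp add: circle_measure_def space_restrict_space)

lemma sets_circle_measure [simp, measurable_cong]:
  "sets circle_measure = sets (restrict_space borel (sphere 0 1))"
  by (simp add: circle_measure_def)

lemma emeasure_angle_interval [simp]: "emeasure lborel {-pi<..pi} = ennreal (2 * pi)"
  by (simp add: emeasure_lborel_Ioc)

lemma measurable_cis [measurable]: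
  "cis \<in> uniform_measure lborel {-pi<..pi} \<rightarrow>\<^sub>M restrict_space borel (sphere 0 1)"
proof -
  have "cis \<in> borel \<rightarrow>\<^sub>M borel"
    by (intro borel_measurable_continuous_onI continuous_intros)
  then show ?thesis
    by (intro measurable_restrict_space2) auto
qed

lemma prob_space_circle_measure: "prob_space circle_measure"
proof -
  have "prob_space (uniform_measure lborel {-pi<..pi})"
    by (rule prob_space_uniform_measure) auto
  then show ?thesis
    unfolding circle_measure_def by (intro prob_space.prob_space_distr) auto
qed

interpretation circle: prob_space circle_measure
  by (rule prob_space_circle_measure)

lemma continuous_measurable_circle [measurable (raw)]:
  fixes g :: "complex \<Rightarrow> 'b::topological_space"
  assumes "continuous_on (sphere 0 1) g"
  shows "g \<in> borel_measurable circle_measure"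
  using borel_measurable_continuous_on_restrict[OF assms]
  by (simp add: measurable_cong_sets[OF sets_circle_measure refl])

lemma continuous_integrable_circle:
  fixes g :: "complex \<Rightarrow> 'b::{banach, second_countable_topology}"
  assumes "continuous_on (sphere 0 1) g"
  shows "integrable circle_measure g"
proof -
  have "compact (g ` sphere 0 1)"
    using assms by (intro compact_continuous_image) auto
  then obtain C where "\<And>u. u \<in> sphere 0 1 \<Longrightarrow> norm (g u) \<le> C"
    by (auto dest!: compact_imp_bounded simp: bounded_iff) (metis mem_sphere_0)
  then show ?thesis
    by (intro circle.integrable_const_bound[of _ C])
      (auto intro!: AE_I2 continuous_measurable_circle assms)
qed

lemma emeasure_circle_measure:
  assumes "A \<in> sets circle_measure"
  shows "emeasure circle_measure A =
    emeasure lborel ({-pi<..pi} \<inter> cis -` A) / ennreal (2 * pi)"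
proof -
  have A: "A \<in> sets (restrict_space borel (sphere 0 1))"
    using assms by simp
  from measurable_sets[OF measurable_cis A] have *: "cis -` A \<in> sets borel" by simp
  show ?thesis
    unfolding circle_measure_def
    by (subst emeasure_distr[OF measurable_cis A])
      (use * in \<open>simp_all add: emeasure_uniform_measure\<close>)
qed

text \<open>
  Divided differences at \<open>\<xi>\<close> satisfy their algebraic identities only away from \<open>\<xi>\<close>; this is
  why these identities may still be integrated.
\<close>

lemma AE_circle_neq: "AE u in circle_measure. u \<noteq> \<xi>"
proof (cases "\<xi> \<in> sphere 0 1")
  case True
  then have A: "{\<xi>} \<in> sets circle_measure"
    by (auto simp: sets_restrict_space)
  have "{-pi<..pi} \<inter> cis -` {\<xi>} \<subseteq> {Arg \<xi>}"
    by (auto simp: cis_Arg_unique)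
  then have "emeasure lborel ({-pi<..pi} \<inter> cis -` {\<xi>}) \<le> emeasure lborel {Arg \<xi>}"
    by (intro emeasure_mono) auto
  then have "emeasure circle_measure {\<xi>} = 0"
    by (simp add: emeasure_circle_measure[OF A])
  then show ?thesis
    using A by (intro AE_I[of _ _ "{\<xi>}"]) auto
next
  case False
  then show ?thesis by (intro AE_I2) auto
qed

lemma cnj_measurable: "cnj \<in> circle_measure \<rightarrow>\<^sub>M circle_measure"
proof -
  have "continuous_on UNIV cnj"
    by (intro continuous_on_cnj continuous_on_id)
  then have "cnj \<in> borel \<rightarrow>\<^sub>M borel"
    by (rule borel_measurable_continuous_onI)
  then show ?thesis
    unfolding measurable_cong_sets[OF sets_circle_measure sets_circle_measure]
    by (rule measurable_restrict_space3) auto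
qed

text \<open>
  Conjugation negates the angle. This moves the missing end point of the half-open interval of
  angles to the other side, which changes it by a null set only.
\<close>

lemma distr_cnj_circle_measure: "distr circle_measure circle_measure cnj = circle_measure"
proof (rule measure_eqI)
  fix A assume "A \<in> sets (distr circle_measure circle_measure cnj)"
  then have A: "A \<in> sets circle_measure" by simp
  define E where "E = cis -` A"
  have E: "E \<in> sets borel"
    using measurable_sets[OF measurable_cis, of A] A by (simp add: E_def)
  have A': "cnj -` A \<inter> space circle_measure \<in> sets circle_measure"
    using measurable_sets[OF cnj_measurable A] .
  have "emeasure (distr circle_measure circle_measure cnj) A =
        emeasure lborel ({-pi<..pi} \<inter> cis -` (cnj -` A \<inter> space circle_measure)) / ennreal (2 * pi)"
    by (simp only: emeasure_distr[OF cnj_measurable A] emeasure_circle_measure[OF A'])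
  also have "{-pi<..pi} \<inter> cis -` (cnj -` A \<inter> space circle_measure) = uminus -` ({-pi..<pi} \<inter> E)"
    by (auto simp: E_def cis_cnj)
  also have "emeasure lborel \<dots> = emeasure (distr lborel borel uminus) ({-pi..<pi} \<inter> E)"
    using E by (subst emeasure_distr) auto
  also have "\<dots> = emeasure lborel ({-pi..<pi} \<inter> E)"
    by (simp only: lborel_distr_uminus)
  also have "\<dots> = emeasure lborel ({-pi<..pi} \<inter> E)"
  proof (rule emeasure_eq_AE)
    show "AE t in lborel. (t \<in> {-pi..<pi} \<inter> E) = (t \<in> {-pi<..pi} \<inter> E)"
      using AE_lborel_singleton[of pi] AE_lborel_singleton[of "-pi"] by eventually_elim auto
  qed (use E in auto)
  also have "\<dots> / ennreal (2 * pi) = emeasure circle_measure A"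
    by (simp add: emeasure_circle_measure[OF A] E_def)
  finally show "emeasure (distr circle_measure circle_measure cnj) A = emeasure circle_measure A" .
qed simp

lemma integral_circle_cnj:
  fixes g :: "complex \<Rightarrow> 'b::{banach, second_countable_topology}"
  assumes "continuous_on (sphere 0 1) g"
  shows "(LINT u|circle_measure. g (cnj u)) = (LINT u|circle_measure. g u)"
proof -
  have "(LINT u|circle_measure. g (cnj u)) = (LINT u|distr circle_measure circle_measure cnj. g u)"
    using assms by (intro integral_distr[symmetric] cnj_measurable continuous_measurable_circle)
  then show ?thesis
    by (simp add: distr_cnj_circle_measure)
qed

lemma integral_circle_measure:
  fixes g :: "complex \<Rightarrow> complex"
  assumes "continuous_on (sphere 0 1) g"
  shows "(LINT u|circle_measure. g u) = integral {-pi..pi} (\<lambda>t. g (cis t)) / (2 * pi)"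
proof -
  have g: "g \<in> borel_measurable (restrict_space borel (sphere 0 1))"
    by (rule borel_measurable_continuous_on_restrict[OF assms])
  have gc: "continuous_on UNIV (\<lambda>t. g (cis t))"
    by (intro continuous_on_compose2[OF assms] continuous_intros) auto
  have [measurable]: "(\<lambda>t. g (cis t)) \<in> borel_measurable borel"
    using gc by (rule borel_measurable_continuous_onI)
  have dens: "uniform_measure lborel {-pi<..pi} =
      density lborel (\<lambda>t. ennreal (indicator {-pi<..pi} t / (2 * pi)))"
    unfolding uniform_measure_def
    by (intro density_cong) (auto simp: divide_ennreal split: split_indicator simp flip: ennreal_1)
  have "(LINT u|circle_measure. g u) = (LINT t|uniform_measure lborel {-pi<..pi}. g (cis t))"
    unfolding circle_measure_def by (intro integral_distr measurable_cis g)
  also have "\<dots> = (LINT t|lborel. (indicator {-pi<..pi} t / (2 * pi)) *\<^sub>R g (cis t))"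
    unfolding dens by (subst integral_density) auto
  also have "\<dots> = (LINT t|lborel. (indicator {-pi..pi} t *\<^sub>R g (cis t)) / (2 * pi))"
  proof (rule integral_cong_AE)
    show "AE t in lborel. (indicator {-pi<..pi} t / (2 * pi)) *\<^sub>R g (cis t) =
        (indicator {-pi..pi} t *\<^sub>R g (cis t)) / (2 * pi)"
      using AE_lborel_singleton[of "-pi"]
      by eventually_elim (auto simp: scaleR_conv_of_real split: split_indicator)
  qed measurable
  also have "\<dots> = (LBINT t:{-pi..pi}. g (cis t)) / (2 * pi)"
    by (simp add: set_lebesgue_integral_def)
  also have "(LBINT t:{-pi..pi}. g (cis t)) = integral {-pi..pi} (\<lambda>t. g (cis t))"
    by (intro set_borel_integral_eq_integral borel_integrable_atLeastAtMost')
       (use gc continuous_on_subset in blast)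
  finally show ?thesis .
qed

text \<open>
  On the circle \<open>u dm = du / (2 \<pi> \<i>)\<close>, so this is Cauchy's theorem.
\<close>

lemma integral_circle_analytic_eq_0:
  assumes "g analytic_on cball 0 1"
  shows "(LINT u|circle_measure. u * g u) = 0"
proof -
  have g: "g holomorphic_on cball 0 1"
    using assms by (rule analytic_imp_holomorphic)
  have cont: "continuous_on (sphere 0 1) (\<lambda>u. u * g u)"
    by (intro continuous_intros continuous_on_subset[OF holomorphic_on_imp_continuous_on[OF g]]) auto
  have "(g has_contour_integral 0) (part_circlepath 0 1 (-pi) pi)"
  proof (rule Cauchy_theorem_convex_simple[OF g])
    show "path_image (part_circlepath 0 1 (- pi) pi) \<subseteq> cball 0 1"
      using path_image_part_circlepath_subset'[of 1 0 "-pi" pi] by auto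
    show "pathfinish (part_circlepath 0 1 (- pi) pi) = pathstart (part_circlepath 0 1 (- pi) pi)"
      by (simp add: cis.ctr exp_minus)
  qed auto
  then have "0 = integral {-pi..pi} (\<lambda>t. g (cis t) * \<i> * cis t)"
    using contour_integral_part_circlepath_eq[of "-pi" pi 0 1 g] by (simp add: contour_integral_unique)
  also have "(\<lambda>t. g (cis t) * \<i> * cis t) = (\<lambda>t. \<i> * (cis t * g (cis t)))"
    by (simp add: mult_ac)
  finally have "integral {-pi..pi} (\<lambda>t. cis t * g (cis t)) = 0"
    by simp
  then show ?thesis
    by (simp add: integral_circle_measure[OF cont])
qed

lemma inverse_eq_cnj_on_circle: "norm u = 1 \<Longrightarrow> inverse u = cnj u" for u :: complex
  by (simp add: divide_conv_cnj inverse_eq_divide)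

section \<open>Separating the poles inside the disc from those outside\<close>

text \<open>
  The value at \<open>\<xi>\<close> fills in the removable singularity, so that analyticity is inherited and
  the construction can be iterated.
\<close>

definition difference_quotient :: "(complex \<Rightarrow> complex) \<Rightarrow> complex \<Rightarrow> complex \<Rightarrow> complex" where
  "difference_quotient f \<xi> u = (if u = \<xi> then deriv f \<xi> else (f u - f \<xi>) / (u - \<xi>))"

text \<open>
  If \<open>f\<close> is a sum of a function analytic on the closed disc and a function \<open>g\<close> that is
  analytic outside the open disc and vanishes at infinity, then this is the number
  \<open>- deriv g \<xi>\<close>: only the poles inside the disc contribute.
\<close>

definition inner_part_functional :: "(complex \<Rightarrow> complex) \<Rightarrow> complex \<Rightarrow> complex" where
  "inner_part_functional f \<xi> =
     (LINT u|circle_measure. u * difference_quotient (difference_quotient f \<xi>) \<xi> u)"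

lemma difference_quotient_analytic_on:
  assumes "f analytic_on S"
  shows "difference_quotient f \<xi> analytic_on S"
proof -
  obtain T where T: "open T" "S \<subseteq> T" "f holomorphic_on T"
    using assms by (auto simp: analytic_on_holomorphic)
  have "difference_quotient f \<xi> holomorphic_on T"
    using pole_lemma_open[OF T(3,1), of \<xi>] by (simp add: difference_quotient_def[abs_def])
  then show ?thesis
    using T by (auto simp: analytic_on_holomorphic)
qed

lemma second_difference_quotient_eq:
  assumes "u \<noteq> \<xi>"
  shows "difference_quotient (difference_quotient f \<xi>) \<xi> u =
    (f u - f \<xi> - deriv f \<xi> * (u - \<xi>)) / (u - \<xi>)\<^sup>2"
  using assms by (simp add: difference_quotient_def field_simps power2_eq_square)

lemma inner_part_functional_eq_0:
  assumes "g analytic_on cball 0 1"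
  shows "inner_part_functional g \<xi> = 0"
  unfolding inner_part_functional_def
  by (intro integral_circle_analytic_eq_0 difference_quotient_analytic_on assms)

lemma analytic_on_circle_continuous:
  "g analytic_on sphere 0 1 \<Longrightarrow> continuous_on (sphere 0 1) g"
  by (intro holomorphic_on_imp_continuous_on analytic_imp_holomorphic)

lemma inner_part_functional_integrable:
  assumes "f analytic_on sphere 0 1"
  shows "integrable circle_measure
    (\<lambda>u. u * difference_quotient (difference_quotient f \<xi>) \<xi> u)"
  by (intro continuous_integrable_circle continuous_intros analytic_on_circle_continuous
      difference_quotient_analytic_on assms)

lemma integral_circle_cong_except:
  fixes f g :: "complex \<Rightarrow> 'b::{banach, second_countable_topology}"
  assumes "continuous_on (sphere 0 1) f" "continuous_on (sphere 0 1) g"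
    and "\<And>u. norm u = 1 \<Longrightarrow> u \<noteq> \<xi> \<Longrightarrow> f u = g u"
  shows "(LINT u|circle_measure. f u) = (LINT u|circle_measure. g u)"
proof (rule integral_cong_AE)
  show "AE u in circle_measure. f u = g u"
    using AE_circle_neq[of \<xi>] AE_space by eventually_elim (use assms(3) in auto)
qed (intro continuous_measurable_circle assms)+

lemma analytic_on_inverse_circle:
  assumes "f analytic_on sphere 0 1"
  shows "(\<lambda>w. f (inverse w)) analytic_on sphere 0 1"
proof -
  have "(f \<circ> inverse) analytic_on sphere 0 1"
    by (intro analytic_on_compose analytic_intros analytic_on_subset[OF assms])
      (auto simp: norm_inverse)
  then show ?thesis by (simp add: o_def)
qed

lemma deriv_inverse_argument:
  fixes f :: "complex \<Rightarrow> complex"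
  assumes "f analytic_on {inverse \<eta>}" "\<eta> \<noteq> 0"
  shows "deriv (\<lambda>w. f (inverse w)) \<eta> = - deriv f (inverse \<eta>) / \<eta>\<^sup>2"
proof -
  have "f field_differentiable at (inverse \<eta>)"
    using assms(1) by (rule analytic_on_imp_differentiable_at) auto
  then have "(f has_field_derivative deriv f (inverse \<eta>)) (at (inverse \<eta>))"
    by (simp add: DERIV_deriv_iff_field_differentiable)
  then have "((\<lambda>w. f (inverse w)) has_field_derivative
      deriv f (inverse \<eta>) * (- (inverse \<eta> ^ Suc (Suc 0)))) (at \<eta>)"
    using DERIV_chain2[OF _ DERIV_inverse[OF assms(2)]] by blast
  then show ?thesis
    by (auto dest!: DERIV_imp_deriv simp: power2_eq_square field_simps)
qed

text \<open>
  Under \<open>u \<mapsto> 1 / u\<close>, which on the circle is conjugation, the integrand for \<open>f\<close> at \<open>\<xi>\<close> becomes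
  \<open>\<eta>\<^sup>2\<close> times the integrand for \<open>h = f \<circ> inverse\<close> at \<open>\<eta> = cnj \<xi>\<close>, plus the constant
  \<open>\<eta>\<^sup>2 deriv h \<eta> = - deriv f \<xi>\<close>.
\<close>

lemma deriv_eq_inner_part_functionals:
  assumes f: "f analytic_on sphere 0 1" and \<xi>: "norm \<xi> = 1"
  shows "deriv f \<xi> = (cnj \<xi>)\<^sup>2 * inner_part_functional (\<lambda>w. f (inverse w)) (cnj \<xi>)
    - inner_part_functional f \<xi>"
proof -
  define \<eta> where "\<eta> = cnj \<xi>"
  define h where "h = (\<lambda>w. f (inverse w))"
  note inv = inverse_eq_cnj_on_circle
  have \<eta>: "norm \<eta> = 1" "\<eta> \<noteq> 0" "\<xi> = inverse \<eta>"
    using \<xi> inv[of "cnj \<xi>"] by (auto simp: \<eta>_def)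
  have h: "h analytic_on sphere 0 1"
    unfolding h_def by (rule analytic_on_inverse_circle[OF f])
  have dh: "deriv f \<xi> = - \<eta>\<^sup>2 * deriv h \<eta>"
    using deriv_inverse_argument[of f \<eta>] analytic_on_subset[OF f, of "{inverse \<eta>}"] \<eta>
    by (simp add: h_def norm_inverse)
  let ?L = "\<lambda>f \<xi>. difference_quotient (difference_quotient f \<xi>) \<xi>"
  have contL: "continuous_on (sphere 0 1) (\<lambda>u. u * ?L f \<xi> u)" if "f analytic_on sphere 0 1" for f \<xi>
    by (intro continuous_intros analytic_on_circle_continuous difference_quotient_analytic_on that)
  have "inner_part_functional f \<xi> = (LINT u|circle_measure. cnj u * ?L f \<xi> (cnj u))"
    unfolding inner_part_functional_def by (rule integral_circle_cnj[OF contL[OF f], symmetric])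
  also have "\<dots> = (LINT u|circle_measure. \<eta>\<^sup>2 * (u * ?L h \<eta> u) + \<eta>\<^sup>2 * deriv h \<eta>)"
  proof (rule integral_circle_cong_except[where \<xi> = \<eta>])
    have "continuous_on (sphere 0 1) ((\<lambda>u. u * ?L f \<xi> u) \<circ> cnj)"
      by (intro continuous_on_compose continuous_on_subset[OF contL[OF f]])
        (auto intro: continuous_intros)
    then show "continuous_on (sphere 0 1) (\<lambda>u. cnj u * ?L f \<xi> (cnj u))"
      by (simp add: o_def)
    show "continuous_on (sphere 0 1) (\<lambda>u. \<eta>\<^sup>2 * (u * ?L h \<eta> u) + \<eta>\<^sup>2 * deriv h \<eta>)"
      by (intro continuous_on_add continuous_on_mult continuous_on_const contL h)
    fix u :: complex assume u: "norm u = 1" "u \<noteq> \<eta>"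
    then have [simp]: "u \<noteq> 0" by auto
    have "cnj u \<noteq> \<xi>" using u by (auto simp: \<eta>_def)
    then have "cnj u * ?L f \<xi> (cnj u) = inverse u *
        (h u - h \<eta> + \<eta>\<^sup>2 * deriv h \<eta> * (inverse u - inverse \<eta>)) / (inverse u - inverse \<eta>)\<^sup>2"
      by (simp add: second_difference_quotient_eq dh[unfolded h_def] h_def inv[OF u(1), symmetric]
          \<eta>(3)[symmetric])
    also have "inverse u - inverse \<eta> = - ((u - \<eta>) / (u * \<eta>))"
      using \<eta> by (simp add: field_simps)
    also have "inverse u * (h u - h \<eta> + \<eta>\<^sup>2 * deriv h \<eta> * - ((u - \<eta>) / (u * \<eta>))) /
          (- ((u - \<eta>) / (u * \<eta>)))\<^sup>2
        = \<eta>\<^sup>2 * (u * ((h u - h \<eta> - deriv h \<eta> * (u - \<eta>)) / (u - \<eta>)\<^sup>2)) + \<eta>\<^sup>2 * deriv h \<eta>"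
    proof -
      have "inverse u * (H + \<eta>\<^sup>2 * d * - (v / (u * \<eta>))) / (- (v / (u * \<eta>)))\<^sup>2
          = (u * \<eta>\<^sup>2 * H - \<eta>\<^sup>2 * d * (\<eta> * v)) / v\<^sup>2" if "v \<noteq> 0" for H d v :: complex
        using that \<eta>(2) by (simp add: field_simps power2_eq_square)
      note this[of "u - \<eta>" "h u - h \<eta>" "deriv h \<eta>"]
      moreover have "u * \<eta>\<^sup>2 * H - \<eta>\<^sup>2 * d * (\<eta> * (u - \<eta>)) =
          \<eta>\<^sup>2 * (u * (H - d * (u - \<eta>))) + \<eta>\<^sup>2 * d * (u - \<eta>)\<^sup>2" for H d
        by (simp add: algebra_simps power2_eq_square)
      ultimately show ?thesis
        using u by (simp add: add_divide_distrib)
    qed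
    finally show "cnj u * ?L f \<xi> (cnj u) = \<eta>\<^sup>2 * (u * ?L h \<eta> u) + \<eta>\<^sup>2 * deriv h \<eta>"
      using u by (simp add: second_difference_quotient_eq)
  qed
  also have "\<dots> = \<eta>\<^sup>2 * inner_part_functional h \<eta> + \<eta>\<^sup>2 * deriv h \<eta>"
    using inner_part_functional_integrable[OF h]
    using circle.prob_space by (simp add: inner_part_functional_def)
  finally show ?thesis
    by (simp add: dh h_def \<eta>_def)
qed

text \<open>
  The second difference quotient depends linearly on the function. Applied to
  \<open>f - 2 f B / B \<xi> + f B\<^sup>2 / (B \<xi>)\<^sup>2 = f (1 - B / B \<xi>)\<^sup>2\<close>, which vanishes to second order at
  \<open>\<xi>\<close>, it is the mere division by \<open>(u - \<xi>)\<^sup>2\<close>. The last two of the three terms are analytic on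
  the disc and contribute nothing to the mean. The function \<open>g\<close> is the analytic continuation
  of \<open>f B\<close>; the two agree near the circle but need not agree at the poles of \<open>f\<close>.
\<close>

lemma inner_part_functional_eq_kernel:
  assumes f: "f analytic_on sphere 0 1" and B: "B analytic_on cball 0 1"
    and g: "g analytic_on cball 0 1"
    and fB: "\<And>u. u \<in> sphere 0 1 \<Longrightarrow> \<forall>\<^sub>F w in nhds u. f w * B w = g w"
    and \<xi>: "norm \<xi> = 1" and B0: "B \<xi> \<noteq> 0"
  shows "inner_part_functional f \<xi> =
    (LINT u|circle_measure. u * f u * (difference_quotient B \<xi> u / B \<xi>)\<^sup>2)"
proof -
  let ?L = "\<lambda>f. difference_quotient (difference_quotient f \<xi>) \<xi>"
  define b where "b = B \<xi>"
  have B': "B analytic_on sphere 0 1" and g': "g analytic_on sphere 0 1"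
    using B g by (auto elim: analytic_on_subset)
  have gB: "(\<lambda>u. g u * B u) analytic_on cball 0 1"
    by (intro analytic_intros B g)
  have gB': "(\<lambda>u. g u * B u) analytic_on sphere 0 1"
    by (intro analytic_intros B' g')
  have df: "(f has_field_derivative deriv f \<xi>) (at \<xi>)" "(B has_field_derivative deriv B \<xi>) (at \<xi>)"
    using \<xi> f B' by (auto simp: DERIV_deriv_iff_field_differentiable
        intro!: analytic_on_imp_differentiable_at)
  have "((\<lambda>w. f w * B w) has_field_derivative deriv f \<xi> * b + deriv B \<xi> * f \<xi>) (at \<xi>)"
    using DERIV_mult[OF df] by (simp add: b_def)
  then have dg: "(g has_field_derivative deriv f \<xi> * b + deriv B \<xi> * f \<xi>) (at \<xi>)"
    using fB[of \<xi>] \<xi> by (subst (asm) DERIV_cong_ev) auto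
  have g_eq: "g u = f u * B u" if "norm u = 1" for u
    using eventually_nhds_x_imp_x[OF fB, of u] that by simp
  have dgB: "((\<lambda>w. g w * B w) has_field_derivative
      (deriv f \<xi> * b + deriv B \<xi> * f \<xi>) * b + deriv B \<xi> * (f \<xi> * b)) (at \<xi>)"
    using DERIV_mult[OF dg df(2)] g_eq[OF \<xi>] by (simp add: b_def)
  have "(LINT u|circle_measure. u * f u * (difference_quotient B \<xi> u / b)\<^sup>2) =
        (LINT u|circle_measure. u * ?L f u - 2 / b * (u * ?L g u) + 1 / b\<^sup>2 * (u * ?L (\<lambda>u. g u * B u) u))"
  proof (rule integral_circle_cong_except[where \<xi> = \<xi>])
    show "continuous_on (sphere 0 1) (\<lambda>u. u * f u * (difference_quotient B \<xi> u / b)\<^sup>2)"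
      using B0 by (intro continuous_intros analytic_on_circle_continuous
          difference_quotient_analytic_on f B') (simp add: b_def)
    show "continuous_on (sphere 0 1)
        (\<lambda>u. u * ?L f u - 2 / b * (u * ?L g u) + 1 / b\<^sup>2 * (u * ?L (\<lambda>u. g u * B u) u))"
      by (intro continuous_on_add continuous_on_diff continuous_on_mult continuous_on_const
          continuous_on_id analytic_on_circle_continuous difference_quotient_analytic_on f gB' g')
    fix u :: complex assume u: "norm u = 1" "u \<noteq> \<xi>"
    have [simp]: "b \<noteq> 0" "u - \<xi> \<noteq> 0" using B0 u by (auto simp: b_def)
    have \<xi>_vals: "g \<xi> = f \<xi> * b" "B \<xi> = b"
      using g_eq[OF \<xi>] by (auto simp: b_def)
    have ders: "deriv g \<xi> = deriv f \<xi> * b + deriv B \<xi> * f \<xi>"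
      "deriv (\<lambda>w. g w * B w) \<xi> = (deriv f \<xi> * b + deriv B \<xi> * f \<xi>) * b + deriv B \<xi> * (f \<xi> * b)"
      using dg dgB by (auto intro: DERIV_imp_deriv)
    have *: "u * F * ((\<beta> - b) / v / b)\<^sup>2 = u * ((F - F0 - d * v) / v\<^sup>2)
        - 2 / b * (u * ((F * \<beta> - F0 * b - (d * b + e * F0) * v) / v\<^sup>2))
        + 1 / b\<^sup>2 * (u * ((F * \<beta> * \<beta> - F0 * b * b - ((d * b + e * F0) * b + e * (F0 * b)) * v) / v\<^sup>2))"
      if "v \<noteq> 0" for F \<beta> F0 d e v :: complex
    proof -
      have "u * F * ((\<beta> - b) / v / b)\<^sup>2 = u * F * (\<beta> - b)\<^sup>2 / (v\<^sup>2 * b\<^sup>2)"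
        by (simp add: power_divide power_mult_distrib)
      also have "u * F * (\<beta> - b)\<^sup>2 = b\<^sup>2 * (u * (F - F0 - d * v))
        - 2 * b * (u * (F * \<beta> - F0 * b - (d * b + e * F0) * v))
        + (u * (F * \<beta> * \<beta> - F0 * b * b - ((d * b + e * F0) * b + e * (F0 * b)) * v))"
        by algebra
      also have "(b\<^sup>2 * (u * X) - 2 * b * (u * Y) + u * Z) / (v\<^sup>2 * b\<^sup>2) =
          u * (X / v\<^sup>2) - 2 / b * (u * (Y / v\<^sup>2)) + 1 / b\<^sup>2 * (u * (Z / v\<^sup>2))" for X Y Z
        using that by (simp add: add_divide_distrib diff_divide_distrib power2_eq_square mult_ac)
      finally show ?thesis .
    qed
    show "u * f u * (difference_quotient B \<xi> u / b)\<^sup>2 =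
        u * ?L f u - 2 / b * (u * ?L g u) + 1 / b\<^sup>2 * (u * ?L (\<lambda>u. g u * B u) u)"
      unfolding second_difference_quotient_eq[OF u(2)] ders \<xi>_vals g_eq[OF u(1)]
      using u by (subst *[symmetric]) (auto simp: difference_quotient_def \<xi>_vals)
  qed
  also have "\<dots> = inner_part_functional f \<xi> - 2 / b * inner_part_functional g \<xi>
      + 1 / b\<^sup>2 * inner_part_functional (\<lambda>u. g u * B u) \<xi>"
    unfolding inner_part_functional_def
    by (simp add: Bochner_Integration.integral_add Bochner_Integration.integral_diff
        inner_part_functional_integrable f g' gB')
  also have "\<dots> = inner_part_functional f \<xi>"
    by (simp add: inner_part_functional_eq_0 g gB)
  finally show ?thesis by (simp add: b_def)
qed

section \<open>Blaschke products and their difference quotients\<close>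

text \<open>
  A family of zeros over an index set, rather than a set of zeros, makes the product with the
  conjugate zeros another instance with the same indices and multiplicities.
\<close>

definition blaschke :: "'i set \<Rightarrow> ('i \<Rightarrow> complex) \<Rightarrow> ('i \<Rightarrow> nat) \<Rightarrow> complex \<Rightarrow> complex" where
  "blaschke A w m z = (\<Prod>i\<in>A. ((z - w i) / (1 - cnj (w i) * z)) ^ m i)"

text \<open>
  For \<open>norm u = 1\<close> the summands are the Poisson kernels of the points \<open>w i\<close>, and the sum is
  the modulus of the derivative of the Blaschke product at \<open>u\<close>.
\<close>

definition poisson_sum :: "'i set \<Rightarrow> ('i \<Rightarrow> complex) \<Rightarrow> ('i \<Rightarrow> nat) \<Rightarrow> complex \<Rightarrow> real" where
  "poisson_sum A w m u = (\<Sum>i\<in>A. real (m i) * ((1 - (norm (w i))\<^sup>2) / (norm (w i - u))\<^sup>2))"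

lemma blaschke_denominator_neq_0:
  fixes a z :: complex
  assumes "norm a < 1" "norm z \<le> 1"
  shows "1 - cnj a * z \<noteq> 0"
proof
  assume "1 - cnj a * z = 0"
  then have "norm (cnj a * z) = 1" by simp
  moreover have "norm (cnj a * z) \<le> norm a * 1"
    using assms by (simp add: norm_mult mult_left_le)
  ultimately show False using assms by simp
qed

lemma blaschke_analytic:
  assumes "\<And>i. i \<in> A \<Longrightarrow> norm (w i) < 1"
  shows "blaschke A w m analytic_on cball 0 1"
  unfolding blaschke_def[abs_def]
  by (intro analytic_intros) (use assms blaschke_denominator_neq_0 in auto)

lemma blaschke_denominator_on_circle:
  fixes a u :: complex
  assumes "norm u = 1"
  shows "1 - cnj a * u = u * cnj (u - a)"
  using assms complex_norm_square[of u] by (simp add: algebra_simps)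

lemma norm_blaschke_denominator:
  fixes a u :: complex
  assumes "norm u = 1"
  shows "norm (1 - cnj a * u) = norm (u - a)"
  by (simp add: blaschke_denominator_on_circle assms norm_mult del: complex_cnj_diff)

lemma norm_blaschke_factor:
  fixes a u :: complex
  assumes "norm a < 1" "norm u = 1"
  shows "norm ((u - a) / (1 - cnj a * u)) = 1"
  using assms by (auto simp: norm_divide norm_blaschke_denominator)

lemma norm_blaschke:
  assumes "\<And>i. i \<in> A \<Longrightarrow> norm (w i) < 1" "norm u = 1"
  shows "norm (blaschke A w m u) = 1"
proof -
  have "norm ((u - w i) / (1 - cnj (w i) * u)) = 1" if "i \<in> A" for i
    using assms that by (intro norm_blaschke_factor) auto
  then show ?thesis
    by (simp add: blaschke_def norm_power flip: prod_norm)
qed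

text \<open>
  The Schwarz reflection of a Blaschke product: its reciprocal is analytic outside the disc,
  including infinity.
\<close>

lemma blaschke_reflection:
  assumes "v \<noteq> 0"
  shows "inverse (blaschke A w m (inverse v)) = blaschke A (cnj \<circ> w) m v"
proof -
  have "inverse ((inverse v - a) / (1 - cnj a * inverse v)) = (v - cnj a) / (1 - a * v)" for a
  proof -
    have "inverse v - a = (1 - a * v) / v" "1 - cnj a * inverse v = (v - cnj a) / v"
      using assms by (simp_all add: field_simps)
    then show ?thesis using assms by simp
  qed
  then show ?thesis
    unfolding blaschke_def by (simp flip: power_inverse prod_inversef)
qed

lemma blaschke_has_derivative:
  assumes "finite A" "\<And>i. i \<in> A \<Longrightarrow> norm (w i) < 1" "norm \<xi> = 1"
  shows "(blaschke A w m has_field_derivative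
    blaschke A w m \<xi> * of_real (poisson_sum A w m \<xi>) / \<xi>) (at \<xi>)"
  using assms(1,2)
proof (induction A rule: finite_induct)
  case empty
  then show ?case by (simp add: blaschke_def poisson_sum_def)
next
  case (insert i A)
  define a b where "a = w i" and "b = (\<lambda>z. (z - a) / (1 - cnj a * z))"
  have a: "norm a < 1" using insert.prems by (auto simp: a_def)
  have nz: "1 - cnj a * \<xi> \<noteq> 0" "\<xi> - a \<noteq> 0" "\<xi> \<noteq> 0"
    using blaschke_denominator_neq_0[OF a] assms(3) a by auto
  have [simp]: "b \<xi> \<noteq> 0" using nz by (simp add: b_def)
  have sq: "(1 - cnj a * \<xi>) * (\<xi> - a) = \<xi> * of_real ((norm (a - \<xi>))\<^sup>2)"
    unfolding blaschke_denominator_on_circle[OF assms(3)] complex_norm_square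
    by (simp add: algebra_simps)
  have one: "of_real (1 - (norm a)\<^sup>2) = 1 - a * cnj a"
    by (simp add: complex_norm_square del: of_real_power)
  have "(b has_field_derivative (1 - a * cnj a) / (1 - cnj a * \<xi>)\<^sup>2) (at \<xi>)"
    unfolding b_def using nz
    by (auto intro!: derivative_eq_intros simp: power2_eq_square algebra_simps)
  also have "(1 - a * cnj a) / (1 - cnj a * \<xi>)\<^sup>2 =
      b \<xi> * ((1 - a * cnj a) / ((1 - cnj a * \<xi>) * (\<xi> - a)))"
    using nz by (simp add: b_def power2_eq_square)
  also have "\<dots> = b \<xi> * of_real ((1 - (norm a)\<^sup>2) / (norm (a - \<xi>))\<^sup>2) / \<xi>"
    unfolding sq one[symmetric] by (simp add: field_simps)
  finally have b: "(b has_field_derivative b \<xi> * of_real ((1 - (norm a)\<^sup>2) / (norm (a - \<xi>))\<^sup>2) / \<xi>) (at \<xi>)" .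
  define t where "t = (1 - (norm a)\<^sup>2) / (norm (a - \<xi>))\<^sup>2"
  have bm: "((\<lambda>z. b z ^ m i) has_field_derivative b \<xi> ^ m i * of_real (real (m i) * t) / \<xi>) (at \<xi>)"
    by (rule derivative_eq_intros b refl | simp)+
       (simp add: t_def power_eq_if field_simps)
  have IH: "(blaschke A w m has_field_derivative
      blaschke A w m \<xi> * of_real (poisson_sum A w m \<xi>) / \<xi>) (at \<xi>)"
    using insert by auto
  have "((\<lambda>z. b z ^ m i * blaschke A w m z) has_field_derivative
      b \<xi> ^ m i * blaschke A w m \<xi> * of_real (real (m i) * t + poisson_sum A w m \<xi>) / \<xi>) (at \<xi>)"
    by (rule DERIV_cong[OF DERIV_mult[OF bm IH]]) (simp add: field_simps add_divide_distrib)
  then show ?case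
    using insert.hyps by (simp add: blaschke_def[abs_def] poisson_sum_def b_def a_def t_def)
qed

lemma poisson_sum_nonneg:
  assumes "\<And>i. i \<in> A \<Longrightarrow> norm (w i) < 1"
  shows "poisson_sum A w m u \<ge> 0"
  unfolding poisson_sum_def using assms
  by (intro sum_nonneg mult_nonneg_nonneg divide_nonneg_nonneg) (auto simp: power_le_one less_imp_le)

text \<open>
  All factors are unimodular on the circle, so the difference of the products is at most the
  sum of the differences of the factors. The difference of a single factor with zero \<open>a\<close> has
  modulus \<open>|u - \<xi>| (1 - |a|\<^sup>2) / (|a - u| |a - \<xi>|)\<close>, and \<open>(1 - |a|\<^sup>2) / (|a - u| |a - \<xi>|)\<close> is
  the geometric mean of the Poisson kernels of \<open>a\<close> at \<open>u\<close> and at \<open>\<xi>\<close>; the Cauchy-Schwarz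
  inequality separates the two points.
\<close>

lemma difference_quotient_blaschke_bound:
  assumes A: "\<And>i. i \<in> A \<Longrightarrow> norm (w i) < 1" and u: "norm u = 1" and \<xi>: "norm \<xi> = 1" and "u \<noteq> \<xi>"
  shows "(norm (difference_quotient (blaschke A w m) \<xi> u))\<^sup>2 \<le> poisson_sum A w m \<xi> * poisson_sum A w m u"
proof -
  define b where "b = (\<lambda>i z. (z - w i) / (1 - cnj (w i) * z))"
  have b1: "norm (b i z) = 1" if "i \<in> A" "norm z = 1" for i z
    unfolding b_def using A that by (intro norm_blaschke_factor) auto
  have diff: "norm (b i u - b i \<xi>) =
      norm (u - \<xi>) * ((1 - (norm (w i))\<^sup>2) / (norm (w i - u) * norm (w i - \<xi>)))" if "i \<in> A" for i
  proof -
    have nz: "1 - cnj (w i) * u \<noteq> 0" "1 - cnj (w i) * \<xi> \<noteq> 0"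
      using blaschke_denominator_neq_0[OF A[OF that]] u \<xi> by auto
    have "b i u - b i \<xi> = (u - \<xi>) * (1 - w i * cnj (w i)) / ((1 - cnj (w i) * u) * (1 - cnj (w i) * \<xi>))"
      unfolding b_def diff_frac_eq[OF nz] by (simp add: algebra_simps)
    also have "1 - w i * cnj (w i) = of_real (1 - (norm (w i))\<^sup>2)"
      by (simp add: complex_norm_square del: of_real_power)
    finally have "norm (b i u - b i \<xi>) = norm (u - \<xi>) * \<bar>1 - (norm (w i))\<^sup>2\<bar> /
        (norm (w i - u) * norm (w i - \<xi>))"
      by (simp add: norm_mult norm_divide norm_blaschke_denominator u \<xi> norm_minus_commute
          del: of_real_diff)
    moreover have "(norm (w i))\<^sup>2 \<le> 1"
      using A[OF that] by (simp add: power_le_one)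
    ultimately show ?thesis by simp
  qed
  define x where "x = (\<lambda>z i. sqrt (real (m i) * (1 - (norm (w i))\<^sup>2)) / norm (w i - z))"
  have x2: "(\<Sum>i\<in>A. (x z i)\<^sup>2) = poisson_sum A w m z" for z
    unfolding poisson_sum_def x_def
    by (intro sum.cong refl) (use A in \<open>simp add: power_divide power_le_one less_imp_le\<close>)
  have "norm (blaschke A w m u - blaschke A w m \<xi>) \<le> (\<Sum>i\<in>A. norm (b i u ^ m i - b i \<xi> ^ m i))"
    unfolding blaschke_def
    by (rule order.trans[OF norm_prod_diff]) (auto simp: b1[unfolded b_def] b_def norm_power u \<xi>)
  also have "\<dots> \<le> (\<Sum>i\<in>A. real (m i) * norm (b i u - b i \<xi>))"
    by (intro sum_mono norm_power_diff) (auto simp: b1 u \<xi>)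
  also have "\<dots> = norm (u - \<xi>) * (\<Sum>i\<in>A. x \<xi> i * x u i)"
    unfolding sum_distrib_left
  proof (intro sum.cong refl)
    fix i assume "i \<in> A"
    then have "0 \<le> real (m i) * (1 - (norm (w i))\<^sup>2)"
      using A by (simp add: power_le_one less_imp_le)
    then show "real (m i) * norm (b i u - b i \<xi>) = norm (u - \<xi>) * (x \<xi> i * x u i)"
      using \<open>i \<in> A\<close> by (simp add: diff x_def mult_ac flip: power2_eq_square)
  qed
  finally have "norm (difference_quotient (blaschke A w m) \<xi> u) \<le> (\<Sum>i\<in>A. x \<xi> i * x u i)"
    using \<open>u \<noteq> \<xi>\<close> by (simp add: difference_quotient_def norm_divide divide_simps mult_ac)
  then have "(norm (difference_quotient (blaschke A w m) \<xi> u))\<^sup>2 \<le> (\<Sum>i\<in>A. x \<xi> i * x u i)\<^sup>2"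
    by (intro power_mono) auto
  also have "\<dots> \<le> (\<Sum>i\<in>A. (x \<xi> i)\<^sup>2) * (\<Sum>i\<in>A. (x u i)\<^sup>2)"
    by (rule Cauchy_Schwarz_ineq_sum)
  finally show ?thesis by (simp add: x2)
qed

lemma poisson_sum_le:
  assumes "\<And>i. i \<in> A \<Longrightarrow> norm (w i) < 1" "norm u = 1"
  shows "poisson_sum A w m u \<le> (\<Sum>i\<in>A. real (m i) * ((1 + norm (w i)) / (1 - norm (w i))))"
  unfolding poisson_sum_def
proof (intro sum_mono mult_left_mono)
  fix i assume "i \<in> A"
  then have i: "norm (w i) < 1" using assms by auto
  have "(1 - norm (w i))\<^sup>2 \<le> (norm (w i - u))\<^sup>2"
    using i assms(2) norm_triangle_ineq2[of u "w i"] by (intro power_mono) (auto simp: norm_minus_commute)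
  then have "(1 - (norm (w i))\<^sup>2) / (norm (w i - u))\<^sup>2 \<le> (1 - (norm (w i))\<^sup>2) / (1 - norm (w i))\<^sup>2"
    using i by (intro divide_left_mono mult_pos_pos) (auto simp: power_le_one assms(2))
  also have "\<dots> = (1 + norm (w i)) / (1 - norm (w i))"
  proof -
    have "1 - (norm (w i))\<^sup>2 = (1 + norm (w i)) * (1 - norm (w i))"
      by (simp add: power2_eq_square algebra_simps)
    then show ?thesis using i by (simp add: power2_eq_square)
  qed
  finally show "(1 - (norm (w i))\<^sup>2) / (norm (w i - u))\<^sup>2 \<le> (1 + norm (w i)) / (1 - norm (w i))" .
qed auto

lemma inner_part_functional_cong:
  assumes "\<And>u. norm u = 1 \<Longrightarrow> \<forall>\<^sub>F w in nhds u. f w = g w" "norm \<xi> = 1"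
  shows "inner_part_functional f \<xi> = inner_part_functional g \<xi>"
proof -
  have d: "deriv f \<xi> = deriv g \<xi>"
    using assms by (intro deriv_cong_ev) auto
  have eq: "f u = g u" if "norm u = 1" for u
    using eventually_nhds_x_imp_x[OF assms(1)[OF that]] .
  have ev: "\<forall>\<^sub>F w in nhds u. difference_quotient f \<xi> w = difference_quotient g \<xi> w" if "norm u = 1" for u
    using assms(1)[OF that] by eventually_elim (simp add: difference_quotient_def d eq assms(2))
  have "deriv (difference_quotient f \<xi>) \<xi> = deriv (difference_quotient g \<xi>) \<xi>"
    using ev assms(2) by (intro deriv_cong_ev) auto
  then show ?thesis
    unfolding inner_part_functional_def
    by (intro Bochner_Integration.integral_cong refl)
      (auto simp: difference_quotient_def d eq assms(2))
qed

text \<open>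
  On the circle \<open>cnj (B u) = 1 / B u\<close>, which turns the squared modulus into a combination of
  the second difference quotients of \<open>B\<close> and of \<open>C = 1 / B\<close>. The mean of the first vanishes.
  Since \<open>C\<close> is analytic outside the disc, the mean of the second is \<open>- deriv C \<xi>\<close>, which is a
  logarithmic derivative up to a factor.
\<close>

lemma integral_norm_difference_quotient_blaschke:
  assumes fin: "finite A" and A: "\<And>i. i \<in> A \<Longrightarrow> norm (w i) < 1" and \<xi>: "norm \<xi> = 1"
  shows "(LINT u|circle_measure. (norm (difference_quotient (blaschke A w m) \<xi> u))\<^sup>2) =
    poisson_sum A w m \<xi>"
proof -
  define B where "B = blaschke A w m"
  define C where "C = (\<lambda>u. inverse (B u))"
  define b where "b = B \<xi>"
  define d where "d = b * of_real (poisson_sum A w m \<xi>) / \<xi>"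
  have [simp]: "\<xi> \<noteq> 0" using \<xi> by auto
  have B1: "norm (B u) = 1" if "norm u = 1" for u
    unfolding B_def using norm_blaschke[OF A that] .
  then have B0: "B u \<noteq> 0" if "norm u = 1" for u
    using that by force
  have [simp]: "b \<noteq> 0" using B0 \<xi> by (simp add: b_def)
  have B: "B analytic_on cball 0 1"
    unfolding B_def using A by (rule blaschke_analytic)
  then have B': "B analytic_on sphere 0 1"
    by (rule analytic_on_subset) auto
  have C: "C analytic_on sphere 0 1"
    unfolding C_def using B0 by (intro analytic_intros B') auto
  have dB: "(B has_field_derivative d) (at \<xi>)"
    unfolding B_def d_def b_def by (rule blaschke_has_derivative[OF fin A \<xi>])
  have dC: "(C has_field_derivative - d / b\<^sup>2) (at \<xi>)"
    unfolding C_def using DERIV_inverse'[OF dB B0[OF \<xi>]]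
    by (simp add: b_def power2_eq_square divide_inverse mult_ac)
  have "inner_part_functional (\<lambda>v. C (inverse v)) (cnj \<xi>) =
      inner_part_functional (blaschke A (cnj \<circ> w) m) (cnj \<xi>)"
  proof (rule inner_part_functional_cong)
    fix u :: complex assume "norm u = 1"
    then have "\<forall>\<^sub>F v in nhds u. v \<noteq> 0"
      by (intro t1_space_nhds) auto
    then show "\<forall>\<^sub>F v in nhds u. C (inverse v) = blaschke A (cnj \<circ> w) m v"
      by eventually_elim (simp add: C_def B_def blaschke_reflection)
  qed (use \<xi> in auto)
  also have "\<dots> = 0"
    by (intro inner_part_functional_eq_0 blaschke_analytic) (use A in auto)
  finally have TC: "inner_part_functional C \<xi> = d / b\<^sup>2"
    using deriv_eq_inner_part_functionals[OF C \<xi>] DERIV_imp_deriv[OF dC] by simp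
  have TB: "inner_part_functional B \<xi> = 0"
    by (rule inner_part_functional_eq_0[OF B])
  let ?L = "\<lambda>f. difference_quotient (difference_quotient f \<xi>) \<xi>"
  have "complex_of_real (LINT u|circle_measure. (norm (difference_quotient B \<xi> u))\<^sup>2) =
        (LINT u|circle_measure. of_real ((norm (difference_quotient B \<xi> u))\<^sup>2))"
    by (rule integral_complex_of_real[symmetric])
  also have "\<dots> = (LINT u|circle_measure. \<xi> / b * (u * ?L B u) + \<xi> * b * (u * ?L C u))"
  proof (rule integral_circle_cong_except[where \<xi> = \<xi>])
    show "continuous_on (sphere 0 1) (\<lambda>u. complex_of_real ((norm (difference_quotient B \<xi> u))\<^sup>2))"
      by (intro continuous_intros analytic_on_circle_continuous difference_quotient_analytic_on B')
    show "continuous_on (sphere 0 1) (\<lambda>u. \<xi> / b * (u * ?L B u) + \<xi> * b * (u * ?L C u))"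
      by (intro continuous_on_add continuous_on_mult continuous_on_const continuous_on_id
          analytic_on_circle_continuous difference_quotient_analytic_on B' C)
    fix u :: complex assume u: "norm u = 1" "u \<noteq> \<xi>"
    define x where "x = B u"
    note cnj = inverse_eq_cnj_on_circle[symmetric]
    have [simp]: "x \<noteq> 0" "u \<noteq> 0" using u B0 by (auto simp: x_def)
    have "complex_of_real ((norm (difference_quotient B \<xi> u))\<^sup>2) =
        ((x - b) / (u - \<xi>)) * ((inverse x - inverse b) / (inverse u - inverse \<xi>))"
      using u \<xi> B1 unfolding complex_norm_square
      by (simp add: difference_quotient_def x_def b_def cnj)
    also have "\<dots> = \<xi> / b * (u * ((x - b - d * (u - \<xi>)) / (u - \<xi>)\<^sup>2)) +
        \<xi> * b * (u * ((inverse x - inverse b - (- d / b\<^sup>2) * (u - \<xi>)) / (u - \<xi>)\<^sup>2))"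
    proof -
      have uv: "inverse u - inverse \<xi> = - ((u - \<xi>) / (u * \<xi>))"
        by (simp add: field_simps)
      have "((x - b) / v) * ((inverse x - inverse b) / - (v / (u * \<xi>))) =
          u * \<xi> * (- ((x - b) * (inverse x - inverse b))) / v\<^sup>2" for v
        by (simp add: power2_eq_square)
      also have "- ((x - b) * (inverse x - inverse b)) =
          inverse b * (x - b - d * v) + b * (inverse x - inverse b - (- d / b\<^sup>2) * v)" for v
        by (simp add: field_simps power2_eq_square)
      also have "u * \<xi> * (inverse b * X + b * Y) / v\<^sup>2 = \<xi> / b * (u * (X / v\<^sup>2)) + \<xi> * b * (u * (Y / v\<^sup>2))"
        for X Y v
        by (simp add: add_divide_distrib distrib_left divide_inverse mult_ac)
      finally show ?thesis
        unfolding uv .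
    qed
    also have "\<dots> = \<xi> / b * (u * ?L B u) + \<xi> * b * (u * ?L C u)"
      using DERIV_imp_deriv[OF dB] DERIV_imp_deriv[OF dC] u
      by (simp add: second_difference_quotient_eq x_def b_def C_def)
    finally show "complex_of_real ((norm (difference_quotient B \<xi> u))\<^sup>2) = 
        \<xi> / b * (u * ?L B u) + \<xi> * b * (u * ?L C u)" .
  qed
  also have "\<dots> = \<xi> / b * inner_part_functional B \<xi> + \<xi> * b * inner_part_functional C \<xi>"
    unfolding inner_part_functional_def
    by (simp add: Bochner_Integration.integral_add inner_part_functional_integrable B' C)
  also have "\<dots> = of_real (poisson_sum A w m \<xi>)"
    by (simp add: TB TC d_def power2_eq_square)
  finally show ?thesis
    by (simp only: of_real_eq_iff B_def)
qed

section \<open>The contribution of the poles inside the disc\<close>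

lemma enn2real_exponent:
  fixes p :: ennreal
  assumes "1 \<le> p" "p \<noteq> \<infinity>"
  shows "1 \<le> enn2real p" "enn2real (1 / p) = 1 / enn2real p"
proof -
  show "1 \<le> enn2real p"
    using assms enn2real_mono[of 1 p] by (simp add: less_top)
  then show "enn2real (1 / p) = 1 / enn2real p"
    using assms by (cases p) (auto simp: divide_ennreal simp flip: ennreal_1)
qed

lemma AE_norm_le_Lp_norm_infinity:
  assumes "continuous_on (sphere 0 1) f"
  shows "AE u in circle_measure. norm (f u) \<le> Lp_norm \<infinity> f"
proof -
  define E where "E = esssup circle_measure (\<lambda>u. ereal (norm (f u)))"
  have "compact (f ` sphere 0 1)"
    using assms by (intro compact_continuous_image) auto
  then obtain C where "\<And>u. u \<in> sphere 0 1 \<Longrightarrow> norm (f u) \<le> C"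
    by (auto dest!: compact_imp_bounded simp: bounded_iff) (metis mem_sphere_0)
  then have "E \<le> ereal C"
    unfolding E_def by (intro esssup_I borel_measurable_ereal continuous_measurable_circle
        continuous_on_norm assms AE_I2) auto
  have E: "AE u in circle_measure. ereal (norm (f u)) \<le> E"
    unfolding E_def by (rule esssup_AE)
  have "E \<noteq> -\<infinity>"
    using E circle.AE_False by (auto)
  then obtain e where "E = ereal e"
    using \<open>E \<le> ereal C\<close> by (cases E) auto
  then show ?thesis
    using E by (simp add: Lp_norm_def flip: E_def)
qed

text \<open>
  Hoelder's inequality for a weight that is known only through its mean \<open>S\<close> and its upper
  bound \<open>D * S\<close>. For a finite exponent \<open>q\<close>, integrating the pointwise inequality
  \<open>x \<le> l ((x / l)\<^sup>q / q + 1 - 1 / q)\<close> against the weight gives the bound \<open>l * S\<close> as soon as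
  \<open>l\<^sup>q\<close> is at least \<open>D\<close> times the integral of \<open>|f|\<^sup>q\<close>.
\<close>

lemma integral_weighted_norm_le_Lp_norm:
  fixes w :: "complex \<Rightarrow> real"
  assumes p: "1 \<le> p" and f: "continuous_on (sphere 0 1) f" and w: "continuous_on (sphere 0 1) w"
    and w0: "\<And>u. w u \<ge> 0" and wD: "AE u in circle_measure. w u \<le> D * S"
    and S: "(LINT u|circle_measure. w u) = S" and D: "D \<ge> 0"
  shows "(LINT u|circle_measure. norm (f u) * w u) \<le> D powr enn2real (1 / p) * S * Lp_norm p f"
proof (cases "D * S = 0")
  case True
  have "AE u in circle_measure. norm (f u) * w u = 0"
    using wD by eventually_elim (use w0 True in \<open>auto intro: antisym\<close>)
  then have "(LINT u|circle_measure. norm (f u) * w u) = (LINT u|circle_measure. 0)"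
    by (intro integral_cong_AE continuous_measurable_circle continuous_intros f w) auto
  then show ?thesis using True by auto
next
  case False
  have S0: "S > 0"
    using False integral_nonneg_AE[of w circle_measure] w0 by (auto simp: S less_le)
  have D0: "D > 0" using False D by auto
  note int = continuous_integrable_circle
  show ?thesis
  proof (cases "p = \<infinity>")
    case True
    have "(LINT u|circle_measure. norm (f u) * w u) \<le> (LINT u|circle_measure. Lp_norm \<infinity> f * w u)"
      using AE_norm_le_Lp_norm_infinity[OF f]
      by (intro integral_mono_AE int continuous_intros f w) (auto elim!: eventually_mono intro: mult_right_mono w0)
    also have "\<dots> = Lp_norm \<infinity> f * S" by (simp add: S)
    finally show ?thesis using True D0 by (simp add: mult_ac)
  next
    case p_fin: False
    define q where "q = enn2real p"
    have "1 \<le> q" and inv_p: "enn2real (1 / p) = 1 / q"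
      unfolding q_def using enn2real_exponent[OF p p_fin] by auto
    define I where "I = (LINT u|circle_measure. norm (f u) powr q)"
    have I0: "I \<ge> 0" unfolding I_def by (intro integral_nonneg_AE AE_I2) auto
    have contp: "continuous_on (sphere 0 1) (\<lambda>u. norm (f u) powr q)"
      using \<open>1 \<le> q\<close> by (intro continuous_on_powr' continuous_intros f) auto
    define L where "L = (D * I) powr (1 / q)"
    have L0: "L \<ge> 0" by (simp add: L_def)
    have young: "x \<le> x powr q / q + (1 - 1 / q)" if "x \<ge> 0" for x :: real
      using Youngs_inequality_0[of "1 / q" "1 - 1 / q" "x powr q" 1] that \<open>1 \<le> q\<close>
      by (cases "x = 0") (simp_all add: powr_powr)
    \<comment> \<open>strict inequality keeps \<open>l\<close> positive even if \<open>f\<close> vanishes on the circle\<close>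
    have bound: "(LINT u|circle_measure. norm (f u) * w u) \<le> l * S" if "l > L" for l
    proof -
      have l: "l > 0" using that L0 by simp
      have DI: "D * I \<le> l powr q"
      proof -
        have "D * I = L powr q"
          using D0 I0 \<open>1 \<le> q\<close> by (simp add: L_def powr_powr)
        also have "\<dots> \<le> l powr q"
          using that L0 \<open>1 \<le> q\<close> by (intro powr_mono2) auto
        finally show ?thesis .
      qed
      have "(LINT u|circle_measure. norm (f u) * w u) \<le>
          (LINT u|circle_measure. l * (D * S / (q * l powr q) * norm (f u) powr q + (1 - 1 / q) * w u))"
      proof (intro integral_mono_AE int continuous_on_mult continuous_on_add continuous_on_const
          continuous_on_norm f w contp)
        show "AE u in circle_measure. norm (f u) * w u \<le>
            l * (D * S / (q * l powr q) * norm (f u) powr q + (1 - 1 / q) * w u)"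
          using wD
        proof eventually_elim
          case (elim u)
          have "norm (f u) * w u = l * (norm (f u) / l * w u)" using l by simp
          also have "\<dots> \<le> l * (((norm (f u) / l) powr q / q + (1 - 1 / q)) * w u)"
            using l w0 by (intro mult_left_mono mult_right_mono young) auto
          also have "\<dots> = l * (norm (f u) powr q / (q * l powr q) * w u + (1 - 1 / q) * w u)"
            using l by (simp add: powr_divide algebra_simps)
          also have "\<dots> \<le> l * (norm (f u) powr q / (q * l powr q) * (D * S) + (1 - 1 / q) * w u)"
            using l elim \<open>1 \<le> q\<close> by (intro mult_left_mono add_right_mono) auto
          finally show ?case by (simp add: mult_ac)
        qed
      qed
      also have "\<dots> = l * (D * S / (q * l powr q) * I + (1 - 1 / q) * S)"
        using int[OF contp] int[OF w] by (simp add: I_def S)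
      also have "\<dots> = l * ((D * I / l powr q) * (S / q) + (1 - 1 / q) * S)"
        by (simp add: mult_ac)
      also have "\<dots> \<le> l * (1 * (S / q) + (1 - 1 / q) * S)"
        using DI l S0 \<open>1 \<le> q\<close>
        by (intro mult_left_mono add_right_mono mult_right_mono) (auto simp: divide_le_eq)
      also have "\<dots> = l * S"
        by (simp add: algebra_simps)
      finally show ?thesis .
    qed
    have "(LINT u|circle_measure. norm (f u) * w u) \<le> L * S"
    proof (rule field_le_epsilon)
      fix e :: real assume "e > 0"
      then have "(LINT u|circle_measure. norm (f u) * w u) \<le> (L + e / S) * S"
        using S0 by (intro bound) auto
      then show "(LINT u|circle_measure. norm (f u) * w u) \<le> L * S + e"
        using S0 by (simp add: algebra_simps)
    qed
    also have "L = D powr (1 / q) * Lp_norm p f"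
      using D0 I0 p_fin by (simp add: L_def powr_mult Lp_norm_def I_def q_def)
    finally show ?thesis by (simp add: inv_p mult_ac)
  qed
qed

text \<open>
  The zero of the Blaschke product at a pole of \<open>f\<close> has the order of that pole, so all
  singularities of the product in the disc are removable.
\<close>

lemma remove_sings_blaschke_mult_analytic:
  assumes mero: "f meromorphic_on UNIV" and f: "f analytic_on sphere 0 1"
    and fin: "finite {a. is_pole f a \<and> norm a < 1}"
  defines "B \<equiv> blaschke {a. is_pole f a \<and> norm a < 1} (\<lambda>a. a) (pole_mult f)"
  shows "remove_sings (\<lambda>z. f z * B z) analytic_on cball 0 1"
proof -
  define A where "A = {a. is_pole f a \<and> norm a < 1}"
  have B_def': "B = blaschke A (\<lambda>a. a) (pole_mult f)" by (simp add: B_def A_def)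
  have B: "B analytic_on cball 0 1"
    unfolding B_def' by (rule blaschke_analytic) (auto simp: A_def)
  have "remove_sings (\<lambda>z. f z * B z) analytic_on {z}" if z: "z \<in> cball 0 1" for z
  proof -
    have fz: "f meromorphic_on {z}" using mero by (rule meromorphic_on_subset) auto
    have Bz: "B analytic_on {z}" using B z by (auto elim: analytic_on_subset)
    have "(\<lambda>z. f z * B z) meromorphic_on {z}"
      by (intro meromorphic_intros fz analytic_on_imp_meromorphic_on Bz)
    then have iso: "isolated_singularity_at (\<lambda>z. f z * B z) z"
      by (auto simp: meromorphic_at_iff)
    have "\<exists>c. (\<lambda>z. f z * B z) \<midarrow>z\<rightarrow> c"
    proof (cases "is_pole f z")
      case False
      then obtain c where "f \<midarrow>z\<rightarrow> c"
        using fz by (auto simp: meromorphic_at_iff not_essential_def)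
      moreover have "B \<midarrow>z\<rightarrow> B z"
        using analytic_at_imp_isCont[OF Bz] by (simp add: isCont_def)
      ultimately show ?thesis by (blast intro: tendsto_mult)
    next
      case True
      have "norm z \<noteq> 1"
        using True analytic_at_imp_no_pole[of f z] analytic_on_subset[OF f, of "{z}"] by auto
      then have zA: "z \<in> A" and z1: "norm z < 1" using z True by (auto simp: A_def)
      obtain r where r: "r > 0" "f analytic_on ball z r - {z}"
        using fz by (auto simp: meromorphic_at_iff isolated_singularity_at_def)
      define n where "n = pole_mult f z"
      obtain g s where s: "s > 0" "g holomorphic_on cball z s"
        and g: "\<And>w. w \<in> cball z s - {z} \<Longrightarrow> f w = g w / (w - z) ^ n"
      proof -
        have "f holomorphic_on ball z r - {z}"
          using r by (intro analytic_imp_holomorphic)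
        from zorder_exist_pole[OF this open_ball _ True] r obtain s where "s > 0"
          "zor_poly f z holomorphic_on cball z s"
          "\<forall>w\<in>cball z s - {z}. f w = zor_poly f z w / (w - z) ^ nat (- zorder f z)"
          by (metis centre_in_ball)
        with True show ?thesis
          by (intro that[of s "zor_poly f z"]) (auto simp: n_def pole_mult_def)
      qed
      define C where "C = blaschke (A - {z}) (\<lambda>a. a) (pole_mult f)"
      have Cz: "isCont C z"
        unfolding C_def by (intro analytic_at_imp_isCont analytic_on_subset[OF blaschke_analytic])
          (use z in \<open>auto simp: A_def\<close>)
      have gz: "isCont g z"
        using s by (intro analytic_at_imp_isCont holomorphic_on_imp_analytic_at[of _ "ball z s"])
          (auto elim: holomorphic_on_subset)
      have Bfac: "B w = ((w - z) / (1 - cnj z * w)) ^ n * C w" for w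
        unfolding B_def' C_def blaschke_def n_def using zA fin
        by (subst prod.remove[of _ z]) (auto simp: A_def)
      have "isCont (\<lambda>w. g w / (1 - cnj z * w) ^ n * C w) z"
        using blaschke_denominator_neq_0[OF z1, of z] z1
        by (intro continuous_intros gz Cz) auto
      then have "(\<lambda>w. g w / (1 - cnj z * w) ^ n * C w) \<midarrow>z\<rightarrow> g z / (1 - cnj z * z) ^ n * C z"
        by (simp add: isCont_def)
      moreover have "\<forall>\<^sub>F w in at z. w \<in> ball z s - {z}"
        using s by (intro eventually_at_in_open) auto
      then have "\<forall>\<^sub>F w in at z. g w / (1 - cnj z * w) ^ n * C w = f w * B w"
        by eventually_elim (auto simp: g Bfac power_divide)
      ultimately have "(\<lambda>w. f w * B w) \<midarrow>z\<rightarrow> g z / (1 - cnj z * z) ^ n * C z"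
        by (rule Lim_transform_eventually)
      then show ?thesis ..
    qed
    then show ?thesis
      using remove_sings_analytic_at[OF iso] by blast
  qed
  then show ?thesis
    by (subst analytic_on_analytic_at) auto
qed

lemma norm_inner_part_functional_le:
  assumes p: "1 \<le> p" and mero: "f meromorphic_on UNIV" and f: "f analytic_on sphere 0 1"
    and fin: "finite {a. is_pole f a \<and> norm a < 1}" and \<xi>: "norm \<xi> = 1"
  shows "norm (inner_part_functional f \<xi>) \<le>
    D1 f powr enn2real (1 / p) * inner_pole_sum f \<xi> * Lp_norm p f"
proof -
  define A where "A = {a. is_pole f a \<and> norm a < 1}"
  define B where "B = blaschke A (\<lambda>a. a) (pole_mult f)"
  define g where "g = remove_sings (\<lambda>z. f z * B z)"
  define w where "w = (\<lambda>u. (norm (difference_quotient B \<xi> u))\<^sup>2)"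
  define S where "S = poisson_sum A (\<lambda>a. a) (pole_mult f)"
  have A: "norm a < 1" if "a \<in> A" for a using that by (simp add: A_def)
  have S_eq: "S u = inner_pole_sum f u" for u
    by (simp add: S_def poisson_sum_def inner_pole_sum_def A_def)
  have D_eq: "D1 f = (\<Sum>a\<in>A. real (pole_mult f a) * ((1 + norm a) / (1 - norm a)))"
    by (simp add: D1_def A_def)
  have B: "B analytic_on cball 0 1"
    unfolding B_def using A by (rule blaschke_analytic)
  then have B': "B analytic_on sphere 0 1"
    by (rule analytic_on_subset) auto
  have g: "g analytic_on cball 0 1"
    unfolding g_def B_def A_def by (rule remove_sings_blaschke_mult_analytic[OF mero f fin])
  have fB: "\<forall>\<^sub>F z in nhds u. f z * B z = g z" if "u \<in> sphere 0 1" for u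
  proof -
    have "(\<lambda>z. f z * B z) analytic_on {u}"
      by (intro analytic_on_mult analytic_on_subset[OF f] analytic_on_subset[OF B']) (use that in auto)
    from eventually_remove_sings_eq_nhds[OF this] show ?thesis
      by eventually_elim (simp add: g_def)
  qed
  have B1: "norm (B u) = 1" if "norm u = 1" for u
    unfolding B_def by (rule norm_blaschke[OF A that])
  have contf: "continuous_on (sphere 0 1) f"
    by (rule analytic_on_circle_continuous[OF f])
  have contq: "continuous_on (sphere 0 1) (difference_quotient B \<xi>)"
    by (intro analytic_on_circle_continuous difference_quotient_analytic_on B')
  have "inner_part_functional f \<xi> =
      (LINT u|circle_measure. u * f u * (difference_quotient B \<xi> u / B \<xi>)\<^sup>2)"
    using B1[OF \<xi>] by (intro inner_part_functional_eq_kernel[OF f B g fB \<xi>]) auto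
  also have "norm \<dots> \<le> (LINT u|circle_measure. norm (u * f u * (difference_quotient B \<xi> u / B \<xi>)\<^sup>2))"
    by (rule integral_norm_bound)
  also have "\<dots> = (LINT u|circle_measure. norm (f u) * w u)"
    by (intro Bochner_Integration.integral_cong refl)
      (auto simp: norm_mult norm_power norm_divide B1 \<xi> w_def)
  also have "\<dots> \<le> D1 f powr enn2real (1 / p) * S \<xi> * Lp_norm p f"
  proof (rule integral_weighted_norm_le_Lp_norm[OF p contf])
    show "continuous_on (sphere 0 1) w"
      unfolding w_def by (intro continuous_intros contq)
    show "(LINT u|circle_measure. w u) = S \<xi>"
      unfolding w_def B_def S_def
      by (rule integral_norm_difference_quotient_blaschke[OF _ A \<xi>]) (simp_all add: A_def fin)
    show "AE u in circle_measure. w u \<le> D1 f * S \<xi>"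
      using AE_circle_neq[of \<xi>] AE_space
    proof eventually_elim
      case (elim u)
      then have u: "norm u = 1" "u \<noteq> \<xi>" by auto
      have "w u \<le> S \<xi> * S u"
        unfolding w_def B_def S_def by (rule difference_quotient_blaschke_bound[OF A u(1) \<xi> u(2)])
      also have "\<dots> \<le> S \<xi> * D1 f"
        unfolding S_def D_eq by (intro mult_left_mono poisson_sum_le poisson_sum_nonneg A u)
      finally show ?case by (simp add: mult_ac)
    qed
    show "D1 f \<ge> 0"
      unfolding D_eq by (intro sum_nonneg mult_nonneg_nonneg divide_nonneg_nonneg)
        (simp_all add: A less_imp_le)
  qed (simp add: w_def)
  finally show ?thesis by (simp add: S_eq)
qed

section \<open>Inversion, and the inequality for rational functions\<close>

lemma is_pole_inverse_argument_iff:
  fixes f :: "complex \<Rightarrow> complex"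
  assumes "a \<noteq> 0"
  shows "is_pole (\<lambda>w. f (inverse w)) a \<longleftrightarrow> is_pole f (inverse a)"
proof
  have tendsto: "inverse \<midarrow>c\<rightarrow> inverse c" if "c \<noteq> 0" for c :: complex
    using that by (intro tendsto_inverse tendsto_ident_at)
  have neq: "\<forall>\<^sub>F w in at c. inverse w \<noteq> inverse c" for c :: complex
    using eventually_neq_at_within[of c c UNIV] by eventually_elim simp
  show "is_pole (\<lambda>w. f (inverse w)) a" if "is_pole f (inverse a)"
    by (rule is_pole_compose[OF that tendsto[OF assms] neq])
  assume "is_pole (\<lambda>w. f (inverse w)) a"
  then have "is_pole (\<lambda>w. f (inverse (inverse w))) (inverse a)"
    using is_pole_compose[of "\<lambda>w. f (inverse w)" a inverse "inverse a"]
      tendsto[of "inverse a"] neq[of "inverse a"] assms by simp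
  then show "is_pole f (inverse a)" by simp
qed

lemma pole_mult_inverse_argument:
  fixes f :: "complex \<Rightarrow> complex"
  assumes "f meromorphic_on UNIV" "a \<noteq> 0"
  shows "pole_mult (\<lambda>w. f (inverse w)) a = pole_mult f (inverse a)"
proof (cases "is_pole f (inverse a)")
  case True
  have "f meromorphic_on {inverse a}"
    using assms(1) by (rule meromorphic_on_subset) auto
  then have f: "isolated_singularity_at f (inverse a)" "not_essential f (inverse a)"
    by (auto simp: meromorphic_at_iff)
  have nz: "\<forall>\<^sub>F w in at (inverse a). f w \<noteq> 0"
    using True by (rule non_zero_neighbour_pole)
  have "zorder (f \<circ> inverse) a = zorder f (inverse a) * zorder (\<lambda>x. inverse x - inverse a) a"
    using assms(2) eventually_neq_at_within[of a a UNIV]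
    by (intro zorder_compose' f nz analytic_intros) (auto elim!: eventually_mono)
  also have "zorder (\<lambda>x. inverse x - inverse a) a = 1"
  proof (rule zorder_eqI)
    show "(\<lambda>x. - inverse (x * a)) holomorphic_on (- {0})"
      using assms(2) by (auto intro!: holomorphic_intros)
    show "inverse w - inverse a = - inverse (w * a) * (w - a) powi 1" if "w \<in> - {0}" for w
      using that assms(2) by (simp add: field_simps)
  qed (use assms(2) in auto)
  finally show ?thesis
    using True assms(2) by (simp add: pole_mult_def is_pole_inverse_argument_iff o_def)
next
  case False
  then show ?thesis using assms(2) by (simp add: pole_mult_def is_pole_inverse_argument_iff)
qed

lemma Lp_norm_inverse_argument:
  assumes f: "continuous_on (sphere 0 1) f" and p: "1 \<le> p"
  shows "Lp_norm p (\<lambda>w. f (inverse w)) = Lp_norm p f"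
proof -
  note inv = inverse_eq_cnj_on_circle
  have contf: "continuous_on (sphere 0 1) (\<lambda>w. f (inverse w))"
    by (intro continuous_on_compose2[OF f] continuous_intros) (auto simp: norm_inverse)
  show ?thesis
  proof (cases "p = \<infinity>")
    case True
    have meas: "(\<lambda>u. ereal (norm (f u))) \<in> borel_measurable circle_measure"
      by (intro borel_measurable_ereal continuous_measurable_circle continuous_on_norm f)
    have meas': "(\<lambda>u. ereal (norm (f (inverse u)))) \<in> borel_measurable circle_measure"
      by (intro borel_measurable_ereal continuous_measurable_circle continuous_on_norm contf)
    have "(AE u in circle_measure. ereal (norm (f (inverse u))) \<le> z) \<longleftrightarrow>
        (AE u in circle_measure. ereal (norm (f u)) \<le> z)" for z
    proof -
      have "(AE u in circle_measure. ereal (norm (f u)) \<le> z) \<longleftrightarrow>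
          (AE u in distr circle_measure circle_measure cnj. ereal (norm (f u)) \<le> z)"
        unfolding distr_cnj_circle_measure ..
      also have "\<dots> \<longleftrightarrow> (AE u in circle_measure. ereal (norm (f (cnj u))) \<le> z)"
      proof (rule AE_distr_iff[OF cnj_measurable])
        show "{u \<in> space circle_measure. ereal (norm (f u)) \<le> z} \<in> sets circle_measure"
          using meas by (rule borel_measurable_le) simp
      qed
      also have "\<dots> \<longleftrightarrow> (AE u in circle_measure. ereal (norm (f (inverse u))) \<le> z)"
        by (rule AE_cong) (simp add: inv)
      finally show ?thesis ..
    qed
    then have "esssup circle_measure (\<lambda>u. ereal (norm (f (inverse u)))) =
        esssup circle_measure (\<lambda>u. ereal (norm (f u)))"
      by (simp add: esssup_eq_AE[OF meas] esssup_eq_AE[OF meas'])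
    then show ?thesis using True by (simp add: Lp_norm_def)
  next
    case False
    then have "enn2real p > 0"
      using enn2real_exponent(1)[OF p] by simp
    then have cont: "continuous_on (sphere 0 1) (\<lambda>u. norm (f u) powr enn2real p)"
      by (intro continuous_on_powr' continuous_on_norm continuous_on_const f) auto
    have "(LINT u|circle_measure. norm (f (inverse u)) powr enn2real p) =
        (LINT u|circle_measure. norm (f (cnj u)) powr enn2real p)"
      by (intro Bochner_Integration.integral_cong refl) (simp add: inv)
    also have "\<dots> = (LINT u|circle_measure. norm (f u) powr enn2real p)"
      by (rule integral_circle_cnj[OF cont])
    finally show ?thesis using False by (simp add: Lp_norm_def)
  qed
qed

text \<open>
  The pole of \<open>f\<close> at infinity, if there is one, is the pole of the reflected function at \<open>0\<close>.
  This is why each sum over outer poles carries one extra term for it.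
\<close>

lemma sum_inner_poles_inverse_argument:
  fixes f :: "complex \<Rightarrow> complex" and \<phi> :: "complex \<Rightarrow> real"
  assumes mero: "f meromorphic_on UNIV" and fin: "finite {a. is_pole f a}"
  defines "h \<equiv> \<lambda>w. f (inverse w)"
  shows "finite {a. is_pole h a \<and> norm a < 1}"
    and "(\<Sum>a | is_pole h a \<and> norm a < 1. real (pole_mult h a) * \<phi> a) =
      (\<Sum>a | is_pole f a \<and> norm a > 1. real (pole_mult f a) * \<phi> (inverse a)) +
      real (pole_mult_infinity f) * \<phi> 0"
proof -
  define A where "A = {a. is_pole f a \<and> norm a > 1}"
  have finA: "finite A" using fin by (rule rev_finite_subset) (auto simp: A_def)
  have *: "{a. is_pole h a \<and> norm a < 1} - {0} = inverse ` A"
  proof (intro equalityI subsetI)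
    fix a assume "a \<in> {a. is_pole h a \<and> norm a < 1} - {0}"
    then have "inverse a \<in> A"
      by (auto simp: A_def h_def is_pole_inverse_argument_iff norm_inverse one_less_inverse)
    then show "a \<in> inverse ` A" by (intro image_eqI[of _ _ "inverse a"]) auto
  next
    fix a assume "a \<in> inverse ` A"
    then obtain b where b: "a = inverse b" "is_pole f b" "norm b > 1" by (auto simp: A_def)
    then have "b \<noteq> 0" by auto
    with b show "a \<in> {a. is_pole h a \<and> norm a < 1} - {0}"
      by (auto simp: h_def is_pole_inverse_argument_iff norm_inverse inverse_less_1_iff)
  qed
  have "finite (insert 0 (inverse ` A))" using finA by auto
  then show fin_h: "finite {a. is_pole h a \<and> norm a < 1}"
    by (rule rev_finite_subset) (use * in auto)
  have "(\<Sum>a | is_pole h a \<and> norm a < 1. real (pole_mult h a) * \<phi> a) =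
      (\<Sum>a\<in>insert 0 (inverse ` A). real (pole_mult h a) * \<phi> a)"
    using finA * by (intro sum.mono_neutral_left) (auto simp: pole_mult_def)
  also have "\<dots> = real (pole_mult h 0) * \<phi> 0 + (\<Sum>a\<in>inverse ` A. real (pole_mult h a) * \<phi> a)"
    using finA by (intro sum.insert) (auto simp: A_def)
  also have "(\<Sum>a\<in>inverse ` A. real (pole_mult h a) * \<phi> a) =
      (\<Sum>a\<in>A. real (pole_mult h (inverse a)) * \<phi> (inverse a))"
    by (subst sum.reindex) (auto intro: inj_onI)
  also have "\<dots> = (\<Sum>a\<in>A. real (pole_mult f a) * \<phi> (inverse a))"
  proof (intro sum.cong refl)
    fix a assume "a \<in> A"
    then have "inverse a \<noteq> 0" by (auto simp: A_def)
    then show "real (pole_mult h (inverse a)) * \<phi> (inverse a) = real (pole_mult f a) * \<phi> (inverse a)"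
      by (simp add: h_def pole_mult_inverse_argument[OF mero])
  qed
  finally show "(\<Sum>a | is_pole h a \<and> norm a < 1. real (pole_mult h a) * \<phi> a) =
      (\<Sum>a | is_pole f a \<and> norm a > 1. real (pole_mult f a) * \<phi> (inverse a)) +
      real (pole_mult_infinity f) * \<phi> 0"
    by (simp add: A_def pole_mult_infinity_def h_def)
qed

lemma D1_inverse_argument:
  assumes "f meromorphic_on UNIV" "finite {a. is_pole f a}"
  shows "D1 (\<lambda>w. f (inverse w)) = D2 f"
proof -
  have "(\<Sum>a | is_pole f a \<and> norm a > 1. real (pole_mult f a) *
        ((1 + norm (inverse a)) / (1 - norm (inverse a)))) =
      (\<Sum>a | is_pole f a \<and> norm a > 1. real (pole_mult f a) * ((norm a + 1) / (norm a - 1)))"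
  proof (intro sum.cong refl)
    fix a :: complex assume "a \<in> {a. is_pole f a \<and> norm a > 1}"
    then have "norm a > 1" by auto
    then have "(1 + norm (inverse a)) / (1 - norm (inverse a)) = (norm a + 1) / (norm a - 1)"
      unfolding norm_inverse by (cases "a = 0") (simp_all add: divide_simps)
    then show "real (pole_mult f a) * ((1 + norm (inverse a)) / (1 - norm (inverse a))) =
        real (pole_mult f a) * ((norm a + 1) / (norm a - 1))" by simp
  qed
  then show ?thesis
    unfolding D1_def D2_def sum_inner_poles_inverse_argument(2)[OF assms] by simp
qed

lemma inner_pole_sum_inverse_argument:
  assumes "f meromorphic_on UNIV" "finite {a. is_pole f a}" and \<xi>: "norm \<xi> = 1"
  shows "inner_pole_sum (\<lambda>w. f (inverse w)) (inverse \<xi>) = outer_pole_sum f \<xi>"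
proof -
  have "\<xi> \<noteq> 0" using \<xi> by auto
  have "(\<Sum>a | is_pole f a \<and> norm a > 1. real (pole_mult f a) *
        ((1 - (norm (inverse a))\<^sup>2) / (norm (inverse a - inverse \<xi>))\<^sup>2)) =
      (\<Sum>a | is_pole f a \<and> norm a > 1. real (pole_mult f a) * (((norm a)\<^sup>2 - 1) / (norm (a - \<xi>))\<^sup>2))"
  proof (intro sum.cong refl)
    fix a :: complex assume "a \<in> {a. is_pole f a \<and> norm a > 1}"
    then have a: "norm a > 1" "a \<noteq> 0" by auto
    then have "inverse a - inverse \<xi> = (\<xi> - a) / (a * \<xi>)"
      using \<open>\<xi> \<noteq> 0\<close> by (simp add: field_simps)
    then have "norm (inverse a - inverse \<xi>) = norm (a - \<xi>) / norm a"
      using \<xi> by (simp add: norm_divide norm_mult norm_minus_commute)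
    moreover have "1 - (norm (inverse a))\<^sup>2 = ((norm a)\<^sup>2 - 1) / (norm a)\<^sup>2"
      unfolding norm_inverse using a by (simp add: field_simps)
    ultimately show "real (pole_mult f a) *
        ((1 - (norm (inverse a))\<^sup>2) / (norm (inverse a - inverse \<xi>))\<^sup>2) =
        real (pole_mult f a) * (((norm a)\<^sup>2 - 1) / (norm (a - \<xi>))\<^sup>2)"
      using a by (simp add: power_divide)
  qed
  then show ?thesis
    unfolding inner_pole_sum_def outer_pole_sum_def sum_inner_poles_inverse_argument(2)[OF assms(1,2)]
    using \<xi> by (simp add: norm_inverse)
qed

text \<open>
  The splitting of the derivative, with the estimate for inner poles applied to both \<open>f\<close> and
  its reflection.
\<close>

lemma bernstein_inequality_meromorphic:
  assumes p: "1 \<le> p" and mero: "f meromorphic_on UNIV" "(\<lambda>w. f (inverse w)) meromorphic_on UNIV"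
    and fin: "finite {a. is_pole f a}" and f: "f analytic_on sphere 0 1" and \<xi>: "norm \<xi> = 1"
  shows "norm (deriv f \<xi>) \<le> (D1 f powr enn2real (1 / p) * inner_pole_sum f \<xi> +
    D2 f powr enn2real (1 / p) * outer_pole_sum f \<xi>) * Lp_norm p f"
proof -
  define h where "h = (\<lambda>w. f (inverse w))"
  have cnj: "cnj \<xi> = inverse \<xi>"
    using inverse_eq_cnj_on_circle[OF \<xi>] ..
  have "norm (deriv f \<xi>) \<le> norm ((cnj \<xi>)\<^sup>2 * inner_part_functional h (cnj \<xi>)) +
      norm (inner_part_functional f \<xi>)"
    unfolding deriv_eq_inner_part_functionals[OF f \<xi>] h_def by (rule norm_triangle_ineq4)
  also have "\<dots> = norm (inner_part_functional h (cnj \<xi>)) + norm (inner_part_functional f \<xi>)"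
    using \<xi> by (simp add: norm_mult norm_power)
  also have "norm (inner_part_functional h (cnj \<xi>)) \<le>
      D1 h powr enn2real (1 / p) * inner_pole_sum h (cnj \<xi>) * Lp_norm p h"
    unfolding h_def using \<xi> sum_inner_poles_inverse_argument(1)[OF mero(1) fin]
    by (intro norm_inner_part_functional_le p mero(2) analytic_on_inverse_circle f) auto
  also have "\<dots> = D2 f powr enn2real (1 / p) * outer_pole_sum f \<xi> * Lp_norm p f"
    by (simp add: h_def cnj D1_inverse_argument[OF mero(1) fin]
        inner_pole_sum_inverse_argument[OF mero(1) fin \<xi>]
        Lp_norm_inverse_argument[OF analytic_on_circle_continuous[OF f] p])
  also have "norm (inner_part_functional f \<xi>) \<le>
      D1 f powr enn2real (1 / p) * inner_pole_sum f \<xi> * Lp_norm p f"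
    using fin by (intro norm_inner_part_functional_le p mero(1) f \<xi>) (auto elim: rev_finite_subset)
  finally show ?thesis by (simp add: algebra_simps)
qed

lemma rational_function_properties:
  assumes "f \<in> rational_functions n"
  shows "f meromorphic_on UNIV" "(\<lambda>w. f (inverse w)) meromorphic_on UNIV"
    "finite {a. is_pole f a}" "f analytic_on sphere 0 1"
proof -
  obtain P Q :: "complex poly" where Q: "\<And>u. norm u = 1 \<Longrightarrow> poly Q u \<noteq> 0"
    and f: "f = (\<lambda>z. poly P z / poly Q z)"
    using assms by (auto simp: rational_functions_def)
  have Q0: "Q \<noteq> 0" using Q[of 1] by auto
  have poly_ana: "poly R analytic_on S" for R :: "complex poly" and S
    unfolding poly_altdef[abs_def] by (intro analytic_intros)
  have poly_mero: "(\<lambda>w. poly R (inverse w)) meromorphic_on UNIV" for R :: "complex poly"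
    unfolding poly_altdef by (intro meromorphic_intros)
  show "f meromorphic_on UNIV"
    unfolding f by (intro meromorphic_intros analytic_on_imp_meromorphic_on poly_ana)
  show "(\<lambda>w. f (inverse w)) meromorphic_on UNIV"
    unfolding f by (intro meromorphic_on_divide poly_mero)
  show "f analytic_on sphere 0 1"
    unfolding f by (intro analytic_on_divide poly_ana) (use Q in auto)
  have "{a. is_pole f a} \<subseteq> {a. poly Q a = 0}"
  proof safe
    fix a assume "is_pole f a"
    show "poly Q a = 0"
    proof (rule ccontr)
      assume "poly Q a \<noteq> 0"
      then have "f analytic_on {a}"
        unfolding f by (intro analytic_on_divide poly_ana) auto
      with \<open>is_pole f a\<close> show False using analytic_at_imp_no_pole by blast
    qed
  qed
  then show "finite {a. is_pole f a}"
    using poly_roots_finite[OF Q0] by (rule finite_subset)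
qed

section \<open>Sharpness\<close>

text \<open>
  The test function is \<open>extremal_profile n \<circ> extremal_map r\<close> away from its pole. It is defined
  as a quotient of polynomials, the composition being multiplied out, so that it is a rational
  function in the sense of \<open>rational_functions\<close> at the pole too.
\<close>

definition extremal_numerator :: "nat \<Rightarrow> real \<Rightarrow> complex poly" where
  "extremal_numerator n r =
     (let k = n div 2; q = [:- of_real r, -1:]; d = [:1, of_real r:]
      in - (q ^ (n - 2 * k) *
           ((q + d) * smult (1 / of_nat k) (\<Sum>j<k. q ^ j * d ^ (k - 1 - j)))\<^sup>2))"

definition extremal_function :: "nat \<Rightarrow> real \<Rightarrow> complex \<Rightarrow> complex" where
  "extremal_function n r z = poly (extremal_numerator n r) z / poly ([:1, of_real r:] ^ n) z"

definition extremal_map :: "real \<Rightarrow> complex \<Rightarrow> complex" where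
  "extremal_map r z = - (z + of_real r) / (1 + of_real r * z)"

text \<open>
  With \<open>k = n div 2\<close>, this is a square of degree \<open>2 k\<close>; the power of \<open>v\<close> in front, which is
  unimodular on the circle, brings the degree up to \<open>n\<close> if \<open>n\<close> is odd. The sign makes the
  derivative at \<open>-1\<close> of the composition positive.
\<close>

definition extremal_profile :: "nat \<Rightarrow> complex \<Rightarrow> complex" where
  "extremal_profile n v =
     - (v ^ (n - 2 * (n div 2)) * ((1 + v) * (\<Sum>j<n div 2. v ^ j) / of_nat (n div 2))\<^sup>2)"

lemma degree_extremal_numerator:
  assumes "n \<ge> 2"
  shows "degree (extremal_numerator n r) \<le> n"
proof -
  define k where "k = n div 2"
  have k: "k \<ge> 1" "2 * k \<le> n" using assms by (auto simp: k_def)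
  define q d where "q = [:- complex_of_real r, -1:]" and "d = [:1, complex_of_real r:]"
  have q: "degree q \<le> 1" and d: "degree d \<le> 1" by (auto simp: q_def d_def)
  have pow: "degree (x ^ j) \<le> j" if "degree x \<le> 1" for x :: "complex poly" and j
    using degree_power_le[of x j] mult_le_mono1[OF that, of j] by linarith
  have s: "degree (\<Sum>j<k. q ^ j * d ^ (k - 1 - j)) \<le> k - 1"
  proof (rule degree_sum_le)
    fix j assume "j \<in> {..<k}"
    then show "degree (q ^ j * d ^ (k - 1 - j)) \<le> k - 1"
      using degree_mult_le[of "q ^ j" "d ^ (k - 1 - j)"] pow[OF q, of j] pow[OF d, of "k - 1 - j"] by auto
  qed simp
  define T where "T = (q + d) * smult (1 / of_nat k) (\<Sum>j<k. q ^ j * d ^ (k - 1 - j))"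
  have "degree T \<le> degree (q + d) + degree (smult (1 / of_nat k) (\<Sum>j<k. q ^ j * d ^ (k - 1 - j)))"
    unfolding T_def by (rule degree_mult_le)
  also have "\<dots> \<le> 1 + (k - 1)"
    using s degree_add_le[OF q d] by (intro add_mono order.trans[OF degree_smult_le]) auto
  finally have T: "degree T \<le> k" using k by simp
  have "degree (q ^ (n - 2 * k) * T\<^sup>2) \<le> degree (q ^ (n - 2 * k)) + degree (T\<^sup>2)"
    by (rule degree_mult_le)
  also have "\<dots> \<le> (n - 2 * k) + k * 2"
    using T by (intro add_mono pow q order.trans[OF degree_power_le]) auto
  also have "\<dots> = n" using k by simp
  finally show ?thesis
    by (simp add: extremal_numerator_def Let_def T_def q_def d_def k_def)
qed

lemma extremal_function_eq:
  assumes "n \<ge> 2" "1 + of_real r * z \<noteq> 0"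
  shows "extremal_function n r z = extremal_profile n (extremal_map r z)"
proof -
  define k v D where "k = n div 2" and "v = extremal_map r z" and "D = 1 + of_real r * z"
  have k: "k \<ge> 1" "2 * k \<le> n" using assms by (auto simp: k_def)
  have D0: "D \<noteq> 0" using assms by (simp add: D_def)
  have q: "poly [:- of_real r, -1:] z = v * D" and d: "poly [:1, of_real r:] z = D"
    using D0 by (simp_all add: v_def extremal_map_def D_def mult.commute)
  have "(\<Sum>j<k. (v * D) ^ j * D ^ (k - 1 - j)) = (\<Sum>j<k. D ^ (k - 1) * v ^ j)"
  proof (intro sum.cong refl)
    fix j assume "j \<in> {..<k}"
    then have "D ^ j * D ^ (k - 1 - j) = D ^ (k - 1)"
      by (simp flip: power_add)
    then show "(v * D) ^ j * D ^ (k - 1 - j) = D ^ (k - 1) * v ^ j"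
      by (simp add: power_mult_distrib)
  qed
  then have s: "(\<Sum>j<k. (v * D) ^ j * D ^ (k - 1 - j)) = D ^ (k - 1) * (\<Sum>j<k. v ^ j)"
    by (simp add: sum_distrib_left)
  have "poly (extremal_numerator n r) z =
      - ((v * D) ^ (n - 2 * k) * ((v * D + D) * (1 / of_nat k * (D ^ (k - 1) * (\<Sum>j<k. v ^ j))))\<^sup>2)"
    unfolding extremal_numerator_def Let_def k_def[symmetric] s[symmetric] poly_minus poly_mult
      poly_power poly_add poly_smult poly_sum q d ..
  also have "(v * D + D) * (1 / of_nat k * (D ^ (k - 1) * (\<Sum>j<k. v ^ j))) =
      D ^ k * ((1 + v) * (\<Sum>j<k. v ^ j) / of_nat k)"
  proof -
    have "(v * D + D) * (1 / K * (E * S)) = (D * E) * ((1 + v) * S / K)" for E S K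
      by (simp add: divide_inverse algebra_simps)
    moreover have "D * D ^ (k - 1) = D ^ k"
      using k by (cases k) simp_all
    ultimately show ?thesis by metis
  qed
  also have "- ((v * D) ^ (n - 2 * k) * (D ^ k * ((1 + v) * (\<Sum>j<k. v ^ j) / of_nat k))\<^sup>2) =
      (D ^ (n - 2 * k) * D ^ (2 * k)) * extremal_profile n v"
  proof -
    have "- ((v * D) ^ e * (D ^ k * X)\<^sup>2) = (D ^ e * D ^ (2 * k)) * - (v ^ e * X\<^sup>2)" for X e
      by (simp add: power_mult_distrib power_mult[symmetric] mult_ac)
    then show ?thesis unfolding extremal_profile_def k_def[symmetric] .
  qed
  also have "D ^ (n - 2 * k) * D ^ (2 * k) = D ^ n"
    using k by (simp flip: power_add)
  finally show ?thesis
    unfolding extremal_function_def poly_power d using D0 by (simp add: v_def)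
qed

context
  fixes n :: nat and r :: real
  assumes n: "n \<ge> 2" and r: "0 < r" "r < 1"
begin

lemma extremal_denominator_eq: "1 + of_real r * z = of_real r * (z - (- (1 / of_real r) :: complex))"
  using r by (simp add: field_simps)

lemma extremal_function_rational: "extremal_function n r \<in> rational_functions n"
proof -
  have "poly ([:1, of_real r:] ^ n) z \<noteq> 0" if "norm z = 1" for z :: complex
    using blaschke_denominator_neq_0[of "- of_real r" z] that r by (simp add: poly_power mult.commute)
  moreover have "degree ([:1, complex_of_real r:] ^ n) \<le> n"
    using degree_power_le[of "[:1, complex_of_real r:]" n] r by simp
  ultimately show ?thesis
    unfolding rational_functions_def using degree_extremal_numerator[OF n, of r]
    unfolding mem_Collect_eq extremal_function_def[abs_def] by blast
qed

lemma extremal_numerator_neq_0: "poly (extremal_numerator n r) (- (1 / of_real r)) \<noteq> 0"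
proof -
  define k where "k = n div 2"
  have k: "k \<ge> 1" using n by (auto simp: k_def)
  define q where "q = 1 / complex_of_real r - of_real r"
  have "1 < 1 / r" using r by simp
  then have "1 / r - r \<noteq> 0" using r by linarith
  then have q0: "q \<noteq> 0"
    unfolding q_def by (metis of_real_1 of_real_diff of_real_divide of_real_eq_0_iff)
  have "(\<Sum>j<k. q ^ j * (0::complex) ^ (k - 1 - j)) = (\<Sum>j\<in>{k - 1}. q ^ j * 0 ^ (k - 1 - j))"
    using k by (intro sum.mono_neutral_right) (auto simp: power_0_left)
  then have s: "(\<Sum>j<k. q ^ j * (0::complex) ^ (k - 1 - j)) = q ^ (k - 1)" by simp
  have pq: "poly [:- of_real r, -1:] (- (1 / of_real r)) = q" "poly [:1, of_real r:] (- (1 / of_real r)) = (0 :: complex)"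
    using r by (simp_all add: q_def)
  have "poly (extremal_numerator n r) (- (1 / of_real r)) =
      - (q ^ (n - 2 * k) * ((q + 0) * (1 / of_nat k * q ^ (k - 1)))\<^sup>2)"
    unfolding extremal_numerator_def Let_def k_def[symmetric] s[symmetric] poly_minus poly_mult
      poly_power poly_add poly_smult poly_sum pq ..
  then show ?thesis using q0 k by simp
qed

lemma extremal_function_pole:
  "is_pole (extremal_function n r) (- (1 / of_real r))"
  "pole_mult (extremal_function n r) (- (1 / of_real r)) = n"
proof -
  define a where "a = (- (1 / of_real r) :: complex)"
  define g where "g = (\<lambda>z. poly (extremal_numerator n r) z / of_real r ^ n)"
  have r0: "complex_of_real r \<noteq> 0" using r by simp
  have g: "g holomorphic_on UNIV"
    unfolding g_def poly_altdef using r0 by (intro holomorphic_intros) auto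
  have g0: "g a \<noteq> 0" using extremal_numerator_neq_0 r by (simp add: g_def a_def)
  have eq: "extremal_function n r = (\<lambda>z. g z / (z - a) ^ n)"
    unfolding extremal_function_def[abs_def] poly_power
    using extremal_denominator_eq
    by (intro ext) (simp add: g_def a_def power_mult_distrib mult.commute)
  show pole: "is_pole (extremal_function n r) (- (1 / of_real r))"
    unfolding eq a_def[symmetric] using n by (intro is_pole_basic[OF g _ _ g0]) auto
  have "zorder (extremal_function n r) a = - int n"
    by (rule zorder_eqI[OF _ _ g g0]) (auto simp: eq power_int_minus field_simps)
  then show "pole_mult (extremal_function n r) (- (1 / of_real r)) = n"
    using pole by (simp add: pole_mult_def a_def)
qed

lemma extremal_function_is_pole_iff:
  "is_pole (extremal_function n r) a \<longleftrightarrow> a = - (1 / of_real r)"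
proof
  assume "is_pole (extremal_function n r) a"
  then have "\<not> extremal_function n r analytic_on {a}"
    using analytic_at_imp_no_pole by blast
  then have "poly ([:1, of_real r:] ^ n) a = 0"
    unfolding extremal_function_def[abs_def] poly_altdef
    by (rule contrapos_np) (auto intro!: analytic_intros)
  then have "1 + of_real r * a = 0"
    by (simp add: poly_power mult.commute split: if_splits)
  then show "a = - (1 / of_real r)"
    using extremal_denominator_eq[of a] r by (simp add: eq_neg_iff_add_eq_0)
qed (use extremal_function_pole in simp)

lemma extremal_function_pole_infinity: "pole_mult_infinity (extremal_function n r) = 0"
proof -
  define h where "h = (\<lambda>w. extremal_profile n (- (1 + of_real r * w) / (w + of_real r)))"
  have "h analytic_on {0}"
    unfolding h_def extremal_profile_def using n r by (auto intro!: analytic_intros)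
  then have "\<not> is_pole h 0" by (rule analytic_at_imp_no_pole)
  moreover have "\<forall>\<^sub>F w in at 0. w \<noteq> - complex_of_real r"
    using r by (intro eventually_neq_at_within)
  then have "\<forall>\<^sub>F w in at 0. extremal_function n r (inverse w) = h w"
    using eventually_neq_at_within[of 0 0 UNIV]
  proof eventually_elim
    case (elim w)
    then have *: "1 + of_real r * inverse w = (w + of_real r) / w" "w + of_real r \<noteq> 0"
      by (auto simp: field_simps add_eq_0_iff)
    then have "1 + of_real r * inverse w \<noteq> 0" using elim by simp
    moreover have "inverse w + of_real r = (1 + of_real r * w) / w"
      using elim by (simp add: field_simps)
    then have "extremal_map r (inverse w) = - (1 + of_real r * w) / (w + of_real r)"
      unfolding extremal_map_def *(1) using elim by simp
    ultimately show ?case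
      using extremal_function_eq[OF n] by (simp add: h_def)
  qed
  ultimately have "\<not> is_pole (\<lambda>w. extremal_function n r (inverse w)) 0"
    using is_pole_cong[of "\<lambda>w. extremal_function n r (inverse w)" h 0 0] by blast
  then show ?thesis
    by (simp add: pole_mult_infinity_def pole_mult_def)
qed

lemma extremal_function_poles_on_circle: "has_poles_on_circle n (1 / r) (extremal_function n r)"
  using r by (simp add: has_poles_on_circle_def extremal_function_is_pole_iff
      extremal_function_pole_infinity extremal_function_pole norm_divide)

lemma extremal_function_pole_sums:
  "D2 (extremal_function n r) = real n * ((1 + r) / (1 - r))"
  "outer_pole_sum (extremal_function n r) (-1) = real n * ((1 + r) / (1 - r))"
proof -
  have poles: "{a. is_pole (extremal_function n r) a \<and> norm a > 1} = {- (1 / of_real r)}"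
    using r by (auto simp: extremal_function_is_pole_iff norm_divide)
  have n1: "norm (- (1 / complex_of_real r)) = 1 / r"
    using r by (simp add: norm_divide)
  have "- (1 / complex_of_real r) - (-1) = of_real (1 - 1 / r)"
    by (simp add: of_real_diff)
  then have n2: "norm (- (1 / complex_of_real r) - (-1)) = 1 / r - 1"
    using r by (simp only: norm_of_real) (simp add: abs_if)
  show "D2 (extremal_function n r) = real n * ((1 + r) / (1 - r))"
    unfolding D2_def poles using r
    by (simp add: extremal_function_pole_infinity extremal_function_pole n1[simplified]) (simp add: divide_simps)
  have "((1 / r)\<^sup>2 - 1) / (1 / r - 1)\<^sup>2 = (1 + r) / (1 - r)"
  proof -
    have "1 / r - 1 \<noteq> 0" using r by simp
    have "(1 / r)\<^sup>2 - 1 = (1 / r - 1) * (1 / r + 1)" by (simp add: power2_eq_square algebra_simps)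
    then have "((1 / r)\<^sup>2 - 1) / (1 / r - 1)\<^sup>2 = (1 / r + 1) / (1 / r - 1)"
      using \<open>1 / r - 1 \<noteq> 0\<close> by (simp add: power2_eq_square)
    then show ?thesis using r by (simp add: divide_simps)
  qed
  then show "outer_pole_sum (extremal_function n r) (-1) = real n * ((1 + r) / (1 - r))"
    unfolding outer_pole_sum_def poles
    by (simp only: sum.insert sum.empty finite.emptyI empty_iff not_False_eq_True n1 n2
        extremal_function_pole extremal_function_pole_infinity)
qed

lemma extremal_function_deriv:
  "deriv (extremal_function n r) (-1) =
    of_real (4 * (real (n - 2 * (n div 2)) + real (n div 2)) * ((1 + r) / (1 - r)))"
proof -
  define k e where "k = n div 2" and "e = n - 2 * k"
  have k: "k \<ge> 1" using n by (auto simp: k_def)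
  have ne: "1 + of_real r * (-1) \<noteq> (0::complex)"
    using r by (metis add_uminus_conv_diff eq_iff_diff_eq_0 less_irrefl mult_minus1_right of_real_eq_1_iff)
  define g where "g = (\<lambda>v::complex. \<Sum>j<k. v ^ j)"
  define h where "h = (\<lambda>v. (1 + v) * g v / of_nat k)"
  have vals: "g 1 = of_nat k" "h 1 = 2"
    using k by (auto simp: g_def h_def)
  have "(g has_field_derivative (\<Sum>j<k. of_nat j)) (at 1)"
    unfolding g_def by (auto intro!: derivative_eq_intros sum.cong)
  moreover have "(\<Sum>j<k. of_nat j) = (of_nat k * (of_nat k - 1) / 2 :: complex)"
    by (induction k) (simp_all add: field_simps)
  ultimately have G: "(g has_field_derivative of_nat k * (of_nat k - 1) / 2) (at 1)"
    by simp
  have H: "(h has_field_derivative of_nat k) (at 1)"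
    unfolding h_def using k by (auto intro!: derivative_eq_intros G simp: vals field_simps)
  have profile: "extremal_profile n = (\<lambda>v. - (v ^ e * (h v)\<^sup>2))"
    by (simp add: extremal_profile_def[abs_def] e_def k_def h_def g_def)
  have F: "(extremal_profile n has_field_derivative - (4 * of_nat (e + k))) (at 1)"
    unfolding profile by (auto intro!: derivative_eq_intros H simp: vals algebra_simps)
  have one: "extremal_map r (-1) = 1"
    using ne by (simp add: extremal_map_def divide_eq_eq)
  have \<phi>: "(extremal_map r has_field_derivative - ((1 + of_real r) / (1 - of_real r))) (at (-1))"
    unfolding extremal_map_def[abs_def] using ne
    by (auto intro!: derivative_eq_intros simp: divide_simps) (simp add: algebra_simps power2_eq_square)
  have "((\<lambda>z. extremal_profile n (extremal_map r z)) has_field_derivative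
      - (4 * of_nat (e + k)) * - ((1 + of_real r) / (1 - of_real r))) (at (-1))"
    using F by (intro DERIV_chain2[OF _ \<phi>]) (simp only: one)
  moreover have "\<forall>\<^sub>F z in nhds (-1). 1 + of_real r * z \<noteq> (0::complex)"
    by (rule tendsto_imp_eventually_ne[OF _ ne]) (intro tendsto_intros filterlim_ident)
  then have "\<forall>\<^sub>F z in nhds (-1). extremal_function n r z = extremal_profile n (extremal_map r z)"
    by eventually_elim (rule extremal_function_eq[OF n])
  ultimately have "(extremal_function n r has_field_derivative
      - (4 * of_nat (e + k)) * - ((1 + of_real r) / (1 - of_real r))) (at (-1))"
    by (subst DERIV_cong_ev[OF refl _ refl])
  then have "deriv (extremal_function n r) (-1) =
      - (4 * of_nat (e + k)) * - ((1 + of_real r) / (1 - of_real r))"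
    by (rule DERIV_imp_deriv)
  also have "\<dots> = 4 * of_nat (e + k) * ((1 + of_real r) / (1 - of_real r))"
    by (simp only: minus_mult_minus)
  finally show ?thesis
    unfolding k_def[symmetric] e_def[symmetric] by simp
qed

text \<open>
  With \<open>v = extremal_map r u\<close>, both \<open>1 - v\<close> and \<open>1 + v\<close> are explicit multiples of \<open>u + 1\<close> and
  of \<open>1 - u\<close> with the common denominator \<open>1 + r u\<close>. The geometric sum \<open>(1 - v\<^sup>k) / (1 - v)\<close>
  times \<open>1 + v\<close> is therefore, up to the bounded factor \<open>1 - u\<close>, a difference quotient at \<open>-1\<close>
  of \<open>v\<^sup>k\<close>, which is a Blaschke product up to sign.
\<close>

lemma extremal_function_norm_bounds:
  assumes u: "norm u = 1"
  shows "norm (extremal_function n r u) \<le> 4"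
    and "u \<noteq> -1 \<Longrightarrow> norm (extremal_function n r u) \<le>
      (2 * (1 - r) / ((1 + r) * real (n div 2)))\<^sup>2 *
      (norm (difference_quotient (blaschke {()} (\<lambda>_. - of_real r) (\<lambda>_. n div 2)) (-1) u))\<^sup>2"
proof -
  define k v where "k = n div 2" and "v = extremal_map r u"
  have k: "k \<ge> 1" using n by (auto simp: k_def)
  have d: "1 + of_real r * u \<noteq> 0"
    using blaschke_denominator_neq_0[of "- of_real r" u] u r by simp
  have v: "norm v = 1"
  proof -
    have "v = - ((u - (- of_real r)) / (1 - cnj (- of_real r) * u))"
      unfolding v_def extremal_map_def minus_divide_left by simp
    then show ?thesis
      using norm_blaschke_factor[of "- of_real r" u] u r by (simp only: norm_minus_cancel) simp
  qed
  have f: "norm (extremal_function n r u) = (norm ((1 + v) * (\<Sum>j<k. v ^ j)) / real k)\<^sup>2"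
    unfolding extremal_function_eq[OF n d] extremal_profile_def v_def[symmetric] k_def[symmetric]
    by (simp add: norm_mult norm_power norm_divide v)
  have "norm ((1 + v) * (\<Sum>j<k. v ^ j)) \<le> 2 * real k"
  proof -
    have "norm (1 + v) \<le> 2" using norm_triangle_ineq[of 1 v] v by simp
    moreover have "norm (\<Sum>j<k. v ^ j) \<le> (\<Sum>j<k. 1)"
      by (intro sum_norm_le) (simp add: norm_power v)
    ultimately show ?thesis unfolding norm_mult by (intro mult_mono) auto
  qed
  then have "norm ((1 + v) * (\<Sum>j<k. v ^ j)) / real k \<le> 2"
    using k by (simp add: divide_le_eq)
  from power_mono[OF this, of 2] show "norm (extremal_function n r u) \<le> 4"
    unfolding f by simp
  assume "u \<noteq> -1"
  define B where "B = blaschke {()} (\<lambda>_. - complex_of_real r) (\<lambda>_. k)"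
  have B_eq: "B z = ((z + of_real r) / (1 + of_real r * z)) ^ k" for z
    by (simp add: B_def blaschke_def)
  have B1: "B (-1) = (-1) ^ k"
  proof -
    have "(- 1 + complex_of_real r) / (1 + of_real r * (- 1)) = -1"
      using r by (simp add: divide_eq_eq)
    then show ?thesis by (simp only: B_eq)
  qed
  have "v = (-1) * ((u + of_real r) / (1 + of_real r * u))"
    by (simp add: v_def extremal_map_def)
  then have vk: "v ^ k = (-1) ^ k * B u"
    by (simp only: power_mult_distrib B_eq)
  have "1 - v = (1 + of_real r) * (u + 1) / (1 + of_real r * u)"
    "1 + v = (1 - of_real r) * (1 - u) / (1 + of_real r * u)"
    using d by (simp_all add: v_def extremal_map_def field_simps)
  note v_eqs = this
  have r1: "1 + complex_of_real r \<noteq> 0"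
    using r by (metis add_less_same_cancel1 less_asym of_real_1 of_real_add of_real_eq_0_iff add_pos_pos zero_less_one less_irrefl)
  have "(1 - v) * (\<Sum>j<k. v ^ j) = 1 - v ^ k"
    by (rule one_diff_power_eq[symmetric])
  also have "1 - v ^ k = (-1) ^ k * (B (-1) - B u)"
    by (simp add: vk B1 algebra_simps flip: power_mult_distrib)
  finally have "(1 - v) * (\<Sum>j<k. v ^ j) = (-1) ^ k * (B (-1) - B u)" .
  moreover have "u + 1 \<noteq> 0" using \<open>u \<noteq> -1\<close> by (simp add: add_eq_0_iff2)
  then have "1 - v \<noteq> 0"
    unfolding v_eqs(1) using r1 d by simp
  ultimately have "(\<Sum>j<k. v ^ j) = (-1) ^ k * (B (-1) - B u) / (1 - v)"
    by (simp add: nonzero_eq_divide_eq mult.commute)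
  then have "(1 + v) * (\<Sum>j<k. v ^ j) =
      (1 - of_real r) * (1 - u) / (1 + of_real r) * ((-1) ^ k * (B (-1) - B u) / (u + 1))"
    unfolding v_eqs using d by simp
  note product_eq = this
  have quotient: "norm (difference_quotient B (-1) u) = norm (B (-1) - B u) / norm (u + 1)"
    using \<open>u \<noteq> -1\<close> by (simp add: difference_quotient_def norm_divide norm_minus_commute)
  have "norm ((1 + v) * (\<Sum>j<k. v ^ j)) =
      (1 - r) * norm (1 - u) / (1 + r) * norm (difference_quotient B (-1) u)"
  proof -
    have "norm (1 - complex_of_real r) = 1 - r" "norm (1 + complex_of_real r) = 1 + r"
      using norm_of_real[of "1 - r", where 'a = complex] norm_of_real[of "1 + r", where 'a = complex] r
      by simp_all
    then show ?thesis
      unfolding product_eq quotient norm_mult norm_divide norm_power by simp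
  qed
  also have "\<dots> \<le> (1 - r) * 2 / (1 + r) * norm (difference_quotient B (-1) u)"
    using r norm_triangle_ineq4[of 1 u] u
    by (intro mult_right_mono divide_right_mono mult_left_mono) auto
  finally have "norm ((1 + v) * (\<Sum>j<k. v ^ j)) / real k \<le>
      (1 - r) * 2 / (1 + r) * norm (difference_quotient B (-1) u) / real k"
    by (rule divide_right_mono) simp
  also have "\<dots> = 2 * (1 - r) / ((1 + r) * real k) * norm (difference_quotient B (-1) u)"
    by simp
  finally have "(norm ((1 + v) * (\<Sum>j<k. v ^ j)) / real k)\<^sup>2 \<le>
      (2 * (1 - r) / ((1 + r) * real k) * norm (difference_quotient B (-1) u))\<^sup>2"
    by (rule power_mono) simp
  then show "norm (extremal_function n r u) \<le>
      (2 * (1 - r) / ((1 + r) * real (n div 2)))\<^sup>2 *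
      (norm (difference_quotient (blaschke {()} (\<lambda>_. - of_real r) (\<lambda>_. n div 2)) (-1) u))\<^sup>2"
    unfolding f power_mult_distrib by (simp add: B_def k_def)
qed

lemma extremal_function_continuous: "continuous_on (sphere 0 1) (extremal_function n r)"
  by (intro analytic_on_circle_continuous rational_function_properties(4)[OF extremal_function_rational])

text \<open>
  The exact mean of the squared difference quotient is \<open>k (1 + r) / (1 - r)\<close>. The factor
  \<open>(2 (1 - r) / ((1 + r) k))\<^sup>2\<close> of the pointwise bound turns it into 4 times its reciprocal,
  which is the concentration that the sharpness needs. As \<open>n \<ge> 2\<close>, replacing \<open>k = n div 2\<close> by
  \<open>n\<close> costs at most a factor 3.
\<close>

lemma integral_norm_extremal_function:
  "(LINT u|circle_measure. norm (extremal_function n r u)) \<le> 12 / (real n * ((1 + r) / (1 - r)))"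
proof -
  define k where "k = n div 2"
  have k: "k \<ge> 1" "n \<le> 3 * k" using n by (auto simp: k_def)
  define B where "B = blaschke {()} (\<lambda>_. - complex_of_real r) (\<lambda>_. k)"
  define c where "c = (2 * (1 - r) / ((1 + r) * real k))\<^sup>2"
  have B: "B analytic_on sphere 0 1"
    unfolding B_def using r by (intro analytic_on_subset[OF blaschke_analytic]) auto
  have "(LINT u|circle_measure. norm (extremal_function n r u)) \<le>
      (LINT u|circle_measure. c * (norm (difference_quotient B (-1) u))\<^sup>2)"
  proof (rule integral_mono_AE)
    show "AE u in circle_measure. norm (extremal_function n r u) \<le>
        c * (norm (difference_quotient B (-1) u))\<^sup>2"
      using AE_circle_neq[of "-1"] AE_space
      by eventually_elim (use extremal_function_norm_bounds(2) in \<open>auto simp: c_def B_def k_def\<close>)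
  qed (intro continuous_integrable_circle continuous_intros extremal_function_continuous
      analytic_on_circle_continuous difference_quotient_analytic_on B)+
  also have "\<dots> = c * poisson_sum {()} (\<lambda>_. - complex_of_real r) (\<lambda>_. k) (-1)"
    unfolding B_def using r
    by (subst integral_norm_difference_quotient_blaschke[symmetric]) auto
  also have "poisson_sum {()} (\<lambda>_. - complex_of_real r) (\<lambda>_. k) (-1) = real k * ((1 + r) / (1 - r))"
  proof -
    have "- complex_of_real r - (-1) = of_real (1 - r)" by simp
    then have "norm (- complex_of_real r - (-1)) = 1 - r"
      using r by (simp only: norm_of_real)
    moreover have "(1 - r\<^sup>2) / (1 - r)\<^sup>2 = (1 + r) / (1 - r)"
    proof -
      have "1 - r\<^sup>2 = (1 + r) * (1 - r)" by (simp add: power2_eq_square algebra_simps)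
      then show ?thesis using r by (simp add: power2_eq_square)
    qed
    ultimately show ?thesis
      using r by (simp add: poisson_sum_def)
  qed
  also have "c * (real k * ((1 + r) / (1 - r))) = 4 / (real k * ((1 + r) / (1 - r)))"
    using r k by (simp add: c_def power2_eq_square divide_simps) (simp add: algebra_simps)
  also have "\<dots> \<le> 12 / (real n * ((1 + r) / (1 - r)))"
  proof -
    have "4 / real k \<le> 12 / real n"
      using k n by (simp add: divide_simps)
    then have "4 / real k / ((1 + r) / (1 - r)) \<le> 12 / real n / ((1 + r) / (1 - r))"
      using r by (intro divide_right_mono) auto
    then show ?thesis by (simp only: divide_divide_eq_left)
  qed
  finally show ?thesis .
qed

text \<open>
  Interpolation between the mean of the modulus and its maximum \<open>4\<close>.
\<close>

lemma Lp_norm_extremal_function_le: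
  assumes p: "1 \<le> p"
  shows "Lp_norm p (extremal_function n r) \<le>
    12 * (real n * ((1 + r) / (1 - r))) powr (- enn2real (1 / p))"
proof -
  define N where "N = real n * ((1 + r) / (1 - r))"
  have N: "N > 0" unfolding N_def using n r by (intro mult_pos_pos divide_pos_pos) auto
  define f where "f = extremal_function n r"
  have cont: "continuous_on (sphere 0 1) f"
    unfolding f_def by (rule extremal_function_continuous)
  have f4: "norm (f u) \<le> 4" if "norm u = 1" for u
    unfolding f_def using extremal_function_norm_bounds(1)[OF that] .
  have "Lp_norm p f \<le> 12 * N powr (- enn2real (1 / p))"
  proof (cases "p = \<infinity>")
    case True
    define E where "E = esssup circle_measure (\<lambda>u. ereal (norm (f u)))"
    have "E \<le> ereal 4"
      unfolding E_def by (intro esssup_I borel_measurable_ereal continuous_measurable_circle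
          continuous_on_norm cont AE_I2) (use f4 in auto)
    then have "real_of_ereal E \<le> 4" by (cases E) auto
    then show ?thesis
      using True N by (simp add: Lp_norm_def E_def)
  next
    case False
    define q where "q = enn2real p"
    have q: "1 \<le> q" and inv_p: "enn2real (1 / p) = 1 / q"
      unfolding q_def using enn2real_exponent[OF p False] by auto
    have contq: "continuous_on (sphere 0 1) (\<lambda>u. norm (f u) powr q)"
      using q by (intro continuous_on_powr' continuous_on_norm continuous_on_const cont) auto
    have "(LINT u|circle_measure. norm (f u) powr q) \<le> (LINT u|circle_measure. 4 powr (q - 1) * norm (f u))"
    proof (intro integral_mono_AE continuous_integrable_circle contq continuous_on_mult
        continuous_on_const continuous_on_norm cont AE_I2)
      fix u assume "u \<in> space circle_measure"
      then have u: "norm (f u) \<le> 4" using f4 by auto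
      have "norm (f u) powr q = norm (f u) powr (q - 1) * norm (f u)"
        using q by (cases "f u = 0") (simp_all add: powr_diff)
      also have "\<dots> \<le> 4 powr (q - 1) * norm (f u)"
        using u q by (intro mult_right_mono powr_mono2) auto
      finally show "norm (f u) powr q \<le> 4 powr (q - 1) * norm (f u)" .
    qed
    also have "\<dots> = 4 powr (q - 1) * (LINT u|circle_measure. norm (f u))"
      by simp
    also have "\<dots> \<le> 4 powr (q - 1) * (12 / N)"
      using integral_norm_extremal_function by (intro mult_left_mono) (auto simp: f_def N_def)
    also have "\<dots> = 4 powr q * (3 * N powr - 1)"
    proof -
      have "4 powr (q - 1) = 4 powr q / 4" by (simp add: powr_diff)
      moreover have "N powr - 1 = 1 / N" using N by (rule powr_neg_one)
      ultimately show ?thesis by simp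
    qed
    finally have "(LINT u|circle_measure. norm (f u) powr q) powr (1 / q) \<le>
        (4 powr q * (3 * N powr - 1)) powr (1 / q)"
      using q by (intro powr_mono2 integral_nonneg_AE AE_I2) auto
    also have "\<dots> = 4 * (3 powr (1 / q) * N powr (- (1 / q)))"
      using q N by (simp add: powr_mult powr_powr powr_divide powr_minus_divide)
    also have "\<dots> \<le> 4 * (3 powr 1 * N powr (- (1 / q)))"
      using q by (intro mult_left_mono mult_right_mono powr_mono) auto
    finally show ?thesis
      using False by (simp add: Lp_norm_def inv_p flip: q_def)
  qed
  then show ?thesis by (simp only: f_def N_def)
qed

end

theorem theorem2p1:
  fixes p :: ennreal
  assumes "1 \<le> p"
  shows "(\<forall>n\<ge>1. \<forall>f \<in> rational_functions n. \<forall>\<xi>. norm \<xi> = 1 \<longrightarrow>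
            norm (deriv f \<xi>)
              \<le> (D1 f powr enn2real (1 / p) * inner_pole_sum f \<xi>
                 + D2 f powr enn2real (1 / p) * outer_pole_sum f \<xi>) * Lp_norm p f)
       \<and> (\<exists>c::real. c > 0 \<and>
            (\<forall>n\<ge>2. \<forall>r::real. 0 < r \<and> r < 1 \<longrightarrow>
              (\<exists>f \<in> rational_functions n. has_poles_on_circle n (1 / r) f \<and>
                 deriv f (-1) \<in> \<real> \<and>
                 Re (deriv f (-1)) / Lp_norm p f
                   \<ge> c * D2 f powr enn2real (1 / p) * outer_pole_sum f (-1))))"
proof (intro conjI allI ballI impI exI[of _ "1 / 6 :: real"])
  have bernstein: "norm (deriv f \<xi>) \<le> (D1 f powr enn2real (1 / p) * inner_pole_sum f \<xi>
      + D2 f powr enn2real (1 / p) * outer_pole_sum f \<xi>) * Lp_norm p f"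
    if "f \<in> rational_functions n" "norm \<xi> = 1" for f n \<xi>
    by (rule bernstein_inequality_meromorphic[OF assms rational_function_properties[OF that(1)] that(2)])
  then show "norm (deriv f \<xi>) \<le> (D1 f powr enn2real (1 / p) * inner_pole_sum f \<xi>
      + D2 f powr enn2real (1 / p) * outer_pole_sum f \<xi>) * Lp_norm p f"
    if "f \<in> rational_functions n" "norm \<xi> = 1" for f n \<xi>
    using that .
  fix n :: nat and r :: real assume n: "n \<ge> 2" and "0 < r \<and> r < 1"
  then have r: "0 < r" "r < 1" by auto
  define f where "f = extremal_function n r"
  define N where "N = real n * ((1 + r) / (1 - r))"
  define s where "s = enn2real (1 / p)"
  have N: "N > 0" unfolding N_def using n r by (intro mult_pos_pos divide_pos_pos) auto
  have f: "f \<in> rational_functions n"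
    unfolding f_def by (rule extremal_function_rational[OF n r])
  define d where "d = 4 * (real (n - 2 * (n div 2)) + real (n div 2)) * ((1 + r) / (1 - r))"
  have deriv: "deriv f (-1) = of_real d"
    unfolding f_def d_def by (rule extremal_function_deriv[OF n r])
  have "n \<le> 2 * ((n - 2 * (n div 2)) + n div 2)"
    by presburger
  then have "real n \<le> 2 * (real (n - 2 * (n div 2)) + real (n div 2))"
    by (metis of_nat_add of_nat_le_iff of_nat_mult of_nat_numeral)
  then have "2 * real n * ((1 + r) / (1 - r)) \<le> d"
    unfolding d_def using r by (intro mult_right_mono) auto
  then have d: "2 * N \<le> d" by (simp add: N_def)
  have sums: "D2 f = N" "outer_pole_sum f (-1) = N"
    unfolding f_def N_def by (rule extremal_function_pole_sums[OF n r])+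
  have Lp: "Lp_norm p f \<le> 12 * N powr - s"
    unfolding f_def N_def s_def by (rule Lp_norm_extremal_function_le[OF n r assms])
  \<comment> \<open>the upper estimate itself rules out a vanishing norm, as the derivative does not vanish\<close>
  have Lp0: "Lp_norm p f > 0"
  proof -
    have "{a. is_pole f a \<and> norm a < 1} = {}"
      using r by (auto simp: f_def extremal_function_is_pole_iff[OF n r] norm_divide)
    then have "inner_pole_sum f (-1) = 0" unfolding inner_pole_sum_def by (simp only: sum.empty)
    then have "norm (deriv f (-1)) \<le> N powr s * N * Lp_norm p f"
      using bernstein[OF f, of "-1"] by (simp add: sums s_def)
    moreover have "norm (deriv f (-1)) > 0"
      using d N by (simp add: deriv)
    ultimately have "0 < (N powr s * N) * Lp_norm p f" by linarith
    moreover have "N powr s * N > 0" using N by simp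
    ultimately show ?thesis by (rule zero_less_mult_pos)
  qed
  have "1 / 6 * N powr s * N = 2 * N / (12 * N powr - s)"
    using N by (simp add: powr_minus divide_simps)
  also have "\<dots> \<le> d / Lp_norm p f"
    using d N Lp Lp0 by (intro frac_le) auto
  finally have "1 / 6 * D2 f powr s * outer_pole_sum f (-1) \<le> Re (deriv f (-1)) / Lp_norm p f"
    by (simp add: sums deriv)
  moreover have "has_poles_on_circle n (1 / r) f"
    unfolding f_def by (rule extremal_function_poles_on_circle[OF n r])
  ultimately show "\<exists>f\<in>rational_functions n. has_poles_on_circle n (1 / r) f \<and>
      deriv f (-1) \<in> \<real> \<and>
      1 / 6 * D2 f powr enn2real (1 / p) * outer_pole_sum f (-1) \<le> Re (deriv f (-1)) / Lp_norm p f"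
    using f deriv by (intro bexI[of _ f]) (auto simp: s_def)
qed simp_all

end
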